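(* Let $F$ be an Archimedean vector lattice. (1) $F$ has PP if and only if for every $e\in F_+$ the Krein-Kakutani spectrum $K_e$ of $e$ is extremally disconnected. (2) $F$ has $\sigma$-PP if and only if for every $e\in F_+$ the Krein-Kakutani spectrum $K_e$ of $e$ is basically disconnected.
   Context: An ideal of a vector lattice $F$ is a linear subspace $E\subset F$ such that $|f|\le|e|$, $e\in E$, $f\in F$ imply $f\in E$. For $e\in F_+$, $I_e=\bigcup_{\alpha\ge0}\alpha[-e,e]$ is the ideal generated by $e$. By the Krein-Kakutani theorem, for Archimedean $F$ there is a compact Hausdorff space $K_e$ such that $I_e$ is vector lattice isomorphic to a norm dense sublattice of $C(K_e)$ (supremum norm); $K_e$ is called the Krein-Kakutani spectrum of $e$. A band is an ideal containing the supremum of any of its subsets whenever this supremum exists; it is countably generated if it is the smallest band containing some countable set. An ideal $H$ is a projection band if $F=H+H^d$, where $H^d=\{f\in F:|f|\wedge|h|=0\text{ for all }h\in H\}$. $F$ has PP if every band in $F$ is a projection band, and $\sigma$-PP if every countably generated band in $F$ is a projection band. A Tychonoff space is extremally disconnected if the closure of every open set is open, and basically disconnected if the closure of every cozero set (a set of the form $\{x: f(x)\ne0\}$ with $f$ continuous real-valued) is open. *)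

theory Defs
  imports "HOL-Analysis.Analysis" "HOL-Library.Lattice_Algebras" "HOL-Library.Lub_Glb"
begin

section \<open>Vector lattices\<close>

class vector_lattice = ordered_real_vector + lattice_ab_group_add_abs

definition archimedean_vl :: "'a::vector_lattice itself \<Rightarrow> bool" where
  "archimedean_vl TYPE('a) \<longleftrightarrow>
     (\<forall>x y :: 'a. (\<forall>n::nat. real n *\<^sub>R x \<le> y) \<longrightarrow> x \<le> 0)"

definition ideal :: "'a::vector_lattice set \<Rightarrow> bool" where
  "ideal E \<longleftrightarrow> subspace E \<and> (\<forall>f e. e \<in> E \<and> \<bar>f\<bar> \<le> \<bar>e\<bar> \<longrightarrow> f \<in> E)"

definition principal_ideal :: "'a::vector_lattice \<Rightarrow> 'a set" where
  "principal_ideal e = (\<Union>\<alpha>\<in>{0::real..}. (\<lambda>x. \<alpha> *\<^sub>R x) ` {- e..e})"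

definition band :: "'a::vector_lattice set \<Rightarrow> bool" where
  "band B \<longleftrightarrow> ideal B \<and> (\<forall>S s. S \<subseteq> B \<and> isLub UNIV S s \<longrightarrow> s \<in> B)"

definition countably_generated_band :: "'a::vector_lattice set \<Rightarrow> bool" where
  "countably_generated_band B \<longleftrightarrow>
     band B \<and> (\<exists>S. countable S \<and> S \<subseteq> B \<and> (\<forall>B'. band B' \<and> S \<subseteq> B' \<longrightarrow> B \<subseteq> B'))"

definition disjoint_complement :: "'a::vector_lattice set \<Rightarrow> 'a set" where
  "disjoint_complement H = {f. \<forall>h\<in>H. inf \<bar>f\<bar> \<bar>h\<bar> = 0}"

definition projection_band :: "'a::vector_lattice set \<Rightarrow> bool" where
  "projection_band H \<longleftrightarrow>
     ideal H \<and> UNIV = {h + k | h k. h \<in> H \<and> k \<in> disjoint_complement H}"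

definition has_PP :: "'a::vector_lattice itself \<Rightarrow> bool" where
  "has_PP TYPE('a) \<longleftrightarrow> (\<forall>B :: 'a set. band B \<longrightarrow> projection_band B)"

definition has_sigma_PP :: "'a::vector_lattice itself \<Rightarrow> bool" where
  "has_sigma_PP TYPE('a) \<longleftrightarrow>
     (\<forall>B :: 'a set. countably_generated_band B \<longrightarrow> projection_band B)"


section \<open>Disconnectedness\<close>

definition extremally_disconnected :: "'k topology \<Rightarrow> bool" where
  "extremally_disconnected X \<longleftrightarrow> (\<forall>U. openin X U \<longrightarrow> openin X (X closure_of U))"

definition cozero_set_in :: "'k topology \<Rightarrow> 'k set \<Rightarrow> bool" where
  "cozero_set_in X U \<longleftrightarrow>
     (\<exists>f. continuous_map X euclideanreal f \<and> U = {x \<in> topspace X. f x \<noteq> 0})"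

definition basically_disconnected :: "'k topology \<Rightarrow> bool" where
  "basically_disconnected X \<longleftrightarrow> (\<forall>U. cozero_set_in X U \<longrightarrow> openin X (X closure_of U))"


section \<open>Krein-Kakutani spectra\<close>

text \<open>
  A continuous function on \<open>K\<close> is represented by its extension by zero to the whole type, so that
  equality in \<open>C(K)\<close> is equality of functions.
\<close>

definition cont_funs :: "'k topology \<Rightarrow> ('k \<Rightarrow> real) set" where
  "cont_funs K = {f. continuous_map K euclideanreal f \<and> (\<forall>x. x \<notin> topspace K \<longrightarrow> f x = 0)}"

definition vector_sublattice :: "'k topology \<Rightarrow> ('k \<Rightarrow> real) set \<Rightarrow> bool" where
  "vector_sublattice K L \<longleftrightarrow>
     L \<subseteq> cont_funs K \<and> (\<lambda>t. 0) \<in> L \<and>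
     (\<forall>f\<in>L. \<forall>g\<in>L. (\<lambda>t. f t + g t) \<in> L \<and> (\<lambda>t. max (f t) (g t)) \<in> L \<and> (\<lambda>t. min (f t) (g t)) \<in> L) \<and>
     (\<forall>f\<in>L. \<forall>c. (\<lambda>t. c * f t) \<in> L)"

definition norm_dense :: "'k topology \<Rightarrow> ('k \<Rightarrow> real) set \<Rightarrow> bool" where
  "norm_dense K L \<longleftrightarrow>
     (\<forall>f\<in>cont_funs K. \<forall>\<epsilon>>0. \<exists>g\<in>L. \<forall>t\<in>topspace K. \<bar>f t - g t\<bar> < \<epsilon>)"

definition vl_isomorphism ::
    "('a::vector_lattice \<Rightarrow> 'k \<Rightarrow> real) \<Rightarrow> 'a set \<Rightarrow> ('k \<Rightarrow> real) set \<Rightarrow> bool" where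
  "vl_isomorphism T E L \<longleftrightarrow>
     bij_betw T E L \<and>
     (\<forall>x\<in>E. \<forall>y\<in>E. T (x + y) = (\<lambda>t. T x t + T y t)) \<and>
     (\<forall>x\<in>E. \<forall>c. T (c *\<^sub>R x) = (\<lambda>t. c * T x t)) \<and>
     (\<forall>x\<in>E. \<forall>y\<in>E. T (sup x y) = (\<lambda>t. max (T x t) (T y t))) \<and>
     (\<forall>x\<in>E. \<forall>y\<in>E. T (inf x y) = (\<lambda>t. min (T x t) (T y t)))"

text \<open>
  The spectrum is determined only up to homeomorphism, so it is a relation between \<open>e\<close> and a
  topological space.  The isomorphism need not send \<open>e\<close> to the constant function 1; density forces
  the image of \<open>e\<close> to be bounded away from 0, so this does not affect uniqueness.
\<close>

definition krein_kakutani_spectrum :: "'a::vector_lattice \<Rightarrow> 'k topology \<Rightarrow> bool" where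
  "krein_kakutani_spectrum e K \<longleftrightarrow>
     compact_space K \<and> Hausdorff_space K \<and>
     (\<exists>T L. vector_sublattice K L \<and> norm_dense K L \<and> vl_isomorphism T (principal_ideal e) L)"


subsection \<open>Existence of the spectrum\<close>

lemma principal_ideal_iff:
  fixes e :: "'a::vector_lattice"
  assumes "0 \<le> e"
  shows "x \<in> principal_ideal e \<longleftrightarrow> (\<exists>a\<ge>0. - (a *\<^sub>R e) \<le> x \<and> x \<le> a *\<^sub>R e)"
proof
  assume "x \<in> principal_ideal e"
  then obtain a y where a: "a \<ge> 0" "- e \<le> y" "y \<le> e" "x = a *\<^sub>R y"
    by (auto simp: principal_ideal_def)
  then have "a *\<^sub>R (- e) \<le> x" "x \<le> a *\<^sub>R e"
    using scaleR_left_mono by blast+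
  with a show "\<exists>a\<ge>0. - (a *\<^sub>R e) \<le> x \<and> x \<le> a *\<^sub>R e" by auto
next
  assume "\<exists>a\<ge>0. - (a *\<^sub>R e) \<le> x \<and> x \<le> a *\<^sub>R e"
  then obtain a where a: "a \<ge> 0" "- (a *\<^sub>R e) \<le> x" "x \<le> a *\<^sub>R e" by auto
  define b where "b = a + 1"
  have b: "b > 0" "a \<le> b" using a by (auto simp: b_def)
  have ab: "a *\<^sub>R e \<le> b *\<^sub>R e" using b assms scaleR_right_mono by blast
  have 1: "x \<le> b *\<^sub>R e" using a(3) ab by (rule order_trans)
  have 2: "b *\<^sub>R (- e) \<le> x" using a(2) ab
    by (metis neg_le_iff_le order_trans scaleR_minus_right)
  have "inverse b *\<^sub>R x \<le> inverse b *\<^sub>R (b *\<^sub>R e)" using 1 b by (intro scaleR_left_mono) auto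
  moreover have "inverse b *\<^sub>R (b *\<^sub>R (- e)) \<le> inverse b *\<^sub>R x"
    using 2 b by (intro scaleR_left_mono) auto
  ultimately have "inverse b *\<^sub>R x \<in> {- e..e}" using b by simp
  moreover have "x = b *\<^sub>R (inverse b *\<^sub>R x)" using b by simp
  ultimately show "x \<in> principal_ideal e"
    unfolding principal_ideal_def using b by (metis UN_I atLeast_iff image_eqI less_imp_le)
qed

lemma principal_ideal_closed:
  fixes e :: "'a::vector_lattice"
  assumes e: "0 \<le> e"
  shows "e \<in> principal_ideal e" "0 \<in> principal_ideal e"
    "x \<in> principal_ideal e \<Longrightarrow> - x \<in> principal_ideal e"
    "x \<in> principal_ideal e \<Longrightarrow> y \<in> principal_ideal e \<Longrightarrow> x + y \<in> principal_ideal e"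
    "x \<in> principal_ideal e \<Longrightarrow> c *\<^sub>R x \<in> principal_ideal e"
    "x \<in> principal_ideal e \<Longrightarrow> y \<in> principal_ideal e \<Longrightarrow> sup x y \<in> principal_ideal e"
    "x \<in> principal_ideal e \<Longrightarrow> y \<in> principal_ideal e \<Longrightarrow> inf x y \<in> principal_ideal e"
proof -
  note I = principal_ideal_iff[OF e]
  have ne: "- e \<le> e" using order_trans[of "- e" 0 e] e by simp
  show "e \<in> principal_ideal e" unfolding I using ne by (intro exI[of _ 1]) auto
  show "0 \<in> principal_ideal e" unfolding I by (intro exI[of _ 0]) auto
  show neg: "x \<in> principal_ideal e \<Longrightarrow> - x \<in> principal_ideal e" for x
  proof -
    assume "x \<in> principal_ideal e"
    then obtain a where "a \<ge> 0" "- (a *\<^sub>R e) \<le> x" "x \<le> a *\<^sub>R e" unfolding I by blast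
    then show "- x \<in> principal_ideal e" unfolding I
      by (intro exI[of _ a]) (simp add: minus_le_iff)
  qed
  show add: "x \<in> principal_ideal e \<Longrightarrow> y \<in> principal_ideal e \<Longrightarrow> x + y \<in> principal_ideal e" for x y
  proof -
    assume "x \<in> principal_ideal e" "y \<in> principal_ideal e"
    then obtain a b where "a \<ge> 0" "- (a *\<^sub>R e) \<le> x" "x \<le> a *\<^sub>R e" "b \<ge> 0" "- (b *\<^sub>R e) \<le> y" "y \<le> b *\<^sub>R e"
      unfolding I by blast
    then show "x + y \<in> principal_ideal e" unfolding I
      using add_mono[of "- (a *\<^sub>R e)" x "- (b *\<^sub>R e)" y] add_mono[of x "a *\<^sub>R e" y "b *\<^sub>R e"]
      by (intro exI[of _ "a + b"]) (simp add: scaleR_left_distrib)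
  qed
  have pos: "c *\<^sub>R x \<in> principal_ideal e" if x: "x \<in> principal_ideal e" and c: "c \<ge> 0" for c x
  proof -
    obtain a where "a \<ge> 0" "- (a *\<^sub>R e) \<le> x" "x \<le> a *\<^sub>R e"
      using x unfolding I by blast
    then show ?thesis unfolding I
      using scaleR_left_mono[of "- (a *\<^sub>R e)" x c] scaleR_left_mono[of x "a *\<^sub>R e" c] c
      by (intro exI[of _ "c * a"]) auto
  qed
  show "x \<in> principal_ideal e \<Longrightarrow> c *\<^sub>R x \<in> principal_ideal e"
    using pos[of x c] neg[OF pos[of x "- c"]] by (cases "c \<ge> 0") auto
  show sup: "x \<in> principal_ideal e \<Longrightarrow> y \<in> principal_ideal e \<Longrightarrow> sup x y \<in> principal_ideal e" for x y
  proof -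
    assume "x \<in> principal_ideal e" "y \<in> principal_ideal e"
    then obtain a b where *: "a \<ge> 0" "- (a *\<^sub>R e) \<le> x" "x \<le> a *\<^sub>R e" "b \<ge> 0" "y \<le> b *\<^sub>R e"
      unfolding I by blast
    have ab: "a *\<^sub>R e \<le> max a b *\<^sub>R e" "b *\<^sub>R e \<le> max a b *\<^sub>R e"
      by (auto intro!: scaleR_right_mono e)
    have "- (max a b *\<^sub>R e) \<le> - (a *\<^sub>R e)" using ab(1) by simp
    also have "\<dots> \<le> x" by (rule *(2))
    also have "x \<le> sup x y" by simp
    finally have "- (max a b *\<^sub>R e) \<le> sup x y" .
    moreover have "sup x y \<le> max a b *\<^sub>R e"
      by (rule sup_least[OF order_trans[OF *(3) ab(1)] order_trans[OF *(5) ab(2)]])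
    ultimately show "sup x y \<in> principal_ideal e" unfolding I
      using * by (intro exI[of _ "max a b"]) auto
  qed
  show "x \<in> principal_ideal e \<Longrightarrow> y \<in> principal_ideal e \<Longrightarrow> inf x y \<in> principal_ideal e"
    using neg[OF sup[OF neg neg, of x y]] by (simp add: neg_sup_eq_inf)
qed

text \<open>
  Sublinear functionals on \<open>I\<^sub>e\<close> that preserve suprema and are normalised at \<open>e\<close>.  The minimal ones
  are exactly the real lattice homomorphisms sending \<open>e\<close> to 1.
\<close>

definition sup_sublinear :: "'a::vector_lattice \<Rightarrow> ('a \<Rightarrow> real) set" where
  "sup_sublinear e = {q. (\<forall>x. x \<notin> principal_ideal e \<longrightarrow> q x = 0) \<and>
     (\<forall>x\<in>principal_ideal e. \<forall>y\<in>principal_ideal e. q (x + y) \<le> q x + q y) \<and>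
     (\<forall>c>0. \<forall>x\<in>principal_ideal e. q (c *\<^sub>R x) \<le> c * q x) \<and>
     (\<forall>x\<in>principal_ideal e. \<forall>y\<in>principal_ideal e. q (sup x y) = max (q x) (q y)) \<and>
     q e \<le> 1 \<and> q (- e) \<le> -1}"

lemma sup_sublinear_zero:
  assumes "0 \<le> e" "q \<in> sup_sublinear e"
  shows "q 0 = 0"
proof -
  have "\<forall>c>0. q 0 \<le> c * q 0"
    using assms principal_ideal_closed(2)[OF assms(1)]
    unfolding sup_sublinear_def by force
  from this[rule_format, of 2] this[rule_format, of "1/2"] show ?thesis by simp
qed

lemma sup_sublinear_mono:
  assumes "q \<in> sup_sublinear e" "x \<in> principal_ideal e" "y \<in> principal_ideal e" "x \<le> y"
  shows "q x \<le> q y"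
proof -
  have "q (sup x y) = max (q x) (q y)" using assms unfolding sup_sublinear_def by blast
  then show ?thesis using assms(4) by (simp add: sup_absorb2)
qed

lemma sup_sublinear_INF:
  fixes e :: "'a::vector_lattice" and C :: "('a \<Rightarrow> real) set"
  assumes e: "0 \<le> e" and ne: "C \<noteq> {}"
    and bdd: "\<And>x. x \<in> principal_ideal e \<Longrightarrow> \<exists>b. \<forall>q\<in>C. b \<le> q x"
    and add: "\<And>q1 q2 x y. q1 \<in> C \<Longrightarrow> q2 \<in> C \<Longrightarrow> x \<in> principal_ideal e \<Longrightarrow> y \<in> principal_ideal e \<Longrightarrow>
        \<exists>q\<in>C. q (x + y) \<le> q1 x + q2 y"
    and hom: "\<And>q c x. q \<in> C \<Longrightarrow> c > 0 \<Longrightarrow> x \<in> principal_ideal e \<Longrightarrow> \<exists>q'\<in>C. q' (c *\<^sub>R x) \<le> c * q x"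
    and sup: "\<And>q1 q2 x y. q1 \<in> C \<Longrightarrow> q2 \<in> C \<Longrightarrow> x \<in> principal_ideal e \<Longrightarrow> y \<in> principal_ideal e \<Longrightarrow>
        \<exists>q\<in>C. q (sup x y) \<le> max (q1 x) (q2 y)"
    and mono: "\<And>q x y. q \<in> C \<Longrightarrow> x \<in> principal_ideal e \<Longrightarrow> y \<in> principal_ideal e \<Longrightarrow> x \<le> y \<Longrightarrow> q x \<le> q y"
    and unit: "\<exists>q\<in>C. q e \<le> 1" "\<exists>q\<in>C. q (- e) \<le> -1"
  shows "(\<lambda>x. if x \<in> principal_ideal e then INF q\<in>C. q x else 0) \<in> sup_sublinear e"
    (is "?r \<in> _")
proof -
  let ?I = "principal_ideal e"
  note cl = principal_ideal_closed[OF e]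
  have lower: "?r x \<le> q x" if "x \<in> ?I" "q \<in> C" for x q
    using that bdd[OF that(1)] by (auto intro!: cINF_lower bdd_belowI2)
  have greatest: "b \<le> ?r x" if "x \<in> ?I" "\<And>q. q \<in> C \<Longrightarrow> b \<le> q x" for b x
    using that ne by (auto intro!: cINF_greatest)
  have 1: "?r (x + y) \<le> ?r x + ?r y" if x: "x \<in> ?I" and y: "y \<in> ?I" for x y
  proof -
    have "?r (x + y) - q1 x \<le> ?r y" if q1: "q1 \<in> C" for q1
    proof (rule greatest[OF y])
      fix q2 assume q2: "q2 \<in> C"
      obtain q where q: "q \<in> C" "q (x + y) \<le> q1 x + q2 y" using add[OF q1 q2 x y] by blast
      show "?r (x + y) - q1 x \<le> q2 y" using lower[OF cl(4)[OF x y] q(1)] q(2) by linarith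
    qed
    then have "?r (x + y) - ?r y \<le> ?r x" by (intro greatest[OF x]) (smt (verit))
    then show ?thesis by linarith
  qed
  have 2: "?r (c *\<^sub>R x) \<le> c * ?r x" if c: "c > 0" and x: "x \<in> ?I" for c x
  proof -
    have "?r (c *\<^sub>R x) / c \<le> ?r x"
    proof (rule greatest[OF x])
      fix q assume q: "q \<in> C"
      obtain q' where q': "q' \<in> C" "q' (c *\<^sub>R x) \<le> c * q x" using hom[OF q c x] by blast
      have "?r (c *\<^sub>R x) \<le> c * q x" using lower[OF cl(5)[OF x] q'(1), of c] q'(2) by linarith
      then show "?r (c *\<^sub>R x) / c \<le> q x" using c by (simp add: field_simps)
    qed
    then show ?thesis using c by (simp only: pos_divide_le_eq mult.commute)
  qed
  have rmono: "?r x \<le> ?r y" if x: "x \<in> ?I" and y: "y \<in> ?I" and xy: "x \<le> y" for x y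
    using lower[OF x] mono[OF _ x y xy] by (intro greatest[OF y]) (smt (verit))
  have 3: "?r (sup x y) = max (?r x) (?r y)" if x: "x \<in> ?I" and y: "y \<in> ?I" for x y
  proof (rule antisym)
    show "max (?r x) (?r y) \<le> ?r (sup x y)"
      using rmono[OF x cl(6)[OF x y]] rmono[OF y cl(6)[OF x y]] by simp
    show "?r (sup x y) \<le> max (?r x) (?r y)"
    proof (rule ccontr)
      assume "\<not> ?thesis"
      then have *: "?r x < ?r (sup x y)" "?r y < ?r (sup x y)" by auto
      obtain q1 where q1: "q1 \<in> C" "q1 x < ?r (sup x y)"
        using greatest[OF x, of "?r (sup x y)"] *(1) by (meson not_less)
      obtain q2 where q2: "q2 \<in> C" "q2 y < ?r (sup x y)"
        using greatest[OF y, of "?r (sup x y)"] *(2) by (meson not_less)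
      obtain q where q: "q \<in> C" "q (sup x y) \<le> max (q1 x) (q2 y)" using sup[OF q1(1) q2(1) x y] by blast
      have "q (sup x y) < ?r (sup x y)" using q(2) q1(2) q2(2) by linarith
      with lower[OF cl(6)[OF x y] q(1)] show False by linarith
    qed
  qed
  have 4: "?r e \<le> 1" using unit(1) lower[OF cl(1)] by (meson order_trans)
  have 5: "?r (- e) \<le> - 1" using unit(2) lower[OF cl(3)[OF cl(1)]] by (meson order_trans)
  have 6: "\<forall>x. x \<notin> ?I \<longrightarrow> ?r x = 0" by simp
  show ?thesis unfolding sup_sublinear_def
    apply (rule CollectI)
    using 1 2 3 4 5 6 by blast
qed

lemma sup_sublinear_neg:
  assumes e: "0 \<le> e" and q: "q \<in> sup_sublinear e" and x: "x \<in> principal_ideal e"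
  shows "- q (- x) \<le> q x"
proof -
  have "q (x + - x) \<le> q x + q (- x)"
    using q x principal_ideal_closed(3)[OF e x] unfolding sup_sublinear_def by blast
  then show ?thesis using sup_sublinear_zero[OF e q] by simp
qed

lemma sup_sublinear_shift:
  assumes e: "0 \<le> e" and q: "q \<in> sup_sublinear e" and y: "y \<in> principal_ideal e"
  shows "\<exists>r\<in>sup_sublinear e. r \<le> q \<and> r (- y) \<le> - q y"
proof -
  let ?I = "principal_ideal e"
  note cl = principal_ideal_closed[OF e]
  have qadd: "\<And>x y. x \<in> ?I \<Longrightarrow> y \<in> ?I \<Longrightarrow> q (x + y) \<le> q x + q y"
    and qhom: "\<And>c x. c > 0 \<Longrightarrow> x \<in> ?I \<Longrightarrow> q (c *\<^sub>R x) \<le> c * q x"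
    and qsup: "\<And>x y. x \<in> ?I \<Longrightarrow> y \<in> ?I \<Longrightarrow> q (sup x y) = max (q x) (q y)"
    and qout: "\<And>x. x \<notin> ?I \<Longrightarrow> q x = 0"
    and qe: "q e \<le> 1" "q (- e) \<le> -1"
    using q unfolding sup_sublinear_def by blast+
  have q0: "q 0 = 0" by (rule sup_sublinear_zero[OF e q])
  have qhom0: "q (c *\<^sub>R x) \<le> c * q x" if "c \<ge> 0" "x \<in> ?I" for c x
    using qhom[of c x] that q0 by (cases "c = 0") auto
  define h where "h = (\<lambda>t x. q (x + t *\<^sub>R y) - t * q y)"
  define C where "C = h ` {0..}"
  have dec: "h s x \<le> h t x" if "t \<le> s" "x \<in> ?I" for s t x
  proof -
    have "q ((x + t *\<^sub>R y) + (s - t) *\<^sub>R y) \<le> q (x + t *\<^sub>R y) + q ((s - t) *\<^sub>R y)"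
      using that by (intro qadd cl y)
    also have "q ((s - t) *\<^sub>R y) \<le> (s - t) * q y" using that by (intro qhom0 y) auto
    finally show ?thesis unfolding h_def by (simp add: algebra_simps)
  qed
  define r where "r = (\<lambda>x. if x \<in> ?I then INF q\<in>C. q x else 0)"
  have bd: "- q (- x) \<le> h t x" if "t \<ge> 0" "x \<in> ?I" for t x
  proof -
    have "q ((x + t *\<^sub>R y) + - x) \<le> q (x + t *\<^sub>R y) + q (- x)" using that by (intro qadd cl y)
    moreover have "(x + t *\<^sub>R y) + - x = t *\<^sub>R y" by simp
    moreover have "t * q y \<le> q (t *\<^sub>R y)"
    proof (cases "t = 0")
      case False
      then have t: "t > 0" using that by simp
      have "q (inverse t *\<^sub>R (t *\<^sub>R y)) \<le> inverse t * q (t *\<^sub>R y)" using t by (intro qhom cl y) auto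
      then show ?thesis using t by (simp add: field_simps)
    qed (simp add: q0)
    ultimately show ?thesis unfolding h_def by simp
  qed
  have "r \<in> sup_sublinear e" unfolding r_def
  proof (rule sup_sublinear_INF[OF e])
    show "C \<noteq> {}" by (auto simp: C_def)
    show "\<exists>b. \<forall>q\<in>C. b \<le> q x" if "x \<in> ?I" for x
      using bd[OF _ that] by (auto simp: C_def)
    show "\<exists>q\<in>C. q (x + z) \<le> q1 x + q2 z" if q12: "q1 \<in> C" "q2 \<in> C" and x: "x \<in> ?I" and z: "z \<in> ?I" for q1 q2 x z
    proof -
      obtain t s where ts: "t \<ge> 0" "s \<ge> 0" "q1 = h t" "q2 = h s" using q12 by (metis C_def atLeast_iff imageE)
      have "q ((x + t *\<^sub>R y) + (z + s *\<^sub>R y)) \<le> q (x + t *\<^sub>R y) + q (z + s *\<^sub>R y)"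
        by (intro qadd cl x y z)
      moreover have "(x + t *\<^sub>R y) + (z + s *\<^sub>R y) = (x + z) + (t + s) *\<^sub>R y"
        by (simp add: algebra_simps)
      ultimately have "h (t + s) (x + z) \<le> q1 x + q2 z"
        unfolding ts h_def by (simp add: algebra_simps)
      then show ?thesis using ts by (auto simp: C_def)
    qed
    show "\<exists>q'\<in>C. q' (c *\<^sub>R x) \<le> c * k x" if k: "k \<in> C" and c: "c > 0" and x: "x \<in> ?I" for k c x
    proof -
      obtain t where t: "t \<ge> 0" "k = h t" using k by (metis C_def atLeast_iff imageE)
      have "q (c *\<^sub>R (x + t *\<^sub>R y)) \<le> c * q (x + t *\<^sub>R y)" by (intro qhom c cl x y)
      then have "h (c * t) (c *\<^sub>R x) \<le> c * k x" unfolding t h_def by (simp add: algebra_simps)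
      then show ?thesis using t c by (auto simp: C_def)
    qed
    show "\<exists>q\<in>C. q (sup x z) \<le> max (q1 x) (q2 z)" if q12: "q1 \<in> C" "q2 \<in> C" and x: "x \<in> ?I" and z: "z \<in> ?I" for q1 q2 x z
    proof -
      obtain t s where ts: "t \<ge> 0" "s \<ge> 0" "q1 = h t" "q2 = h s" using q12 by (metis C_def atLeast_iff imageE)
      define u where "u = max t s"
      have u: "u \<ge> 0" "t \<le> u" "s \<le> u" using ts by (auto simp: u_def)
      have "sup x z + u *\<^sub>R y = sup (x + u *\<^sub>R y) (z + u *\<^sub>R y)" by (rule add_sup_distrib_right)
      then have "q (sup x z + u *\<^sub>R y) = max (q (x + u *\<^sub>R y)) (q (z + u *\<^sub>R y))"
        using qsup[of "x + u *\<^sub>R y" "z + u *\<^sub>R y"] x y z by (simp add: cl)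
      then have "h u (sup x z) = max (h u x) (h u z)" unfolding h_def by linarith
      also have "\<dots> \<le> max (q1 x) (q2 z)" using dec[OF u(2) x] dec[OF u(3) z] ts by (intro max.mono) auto
      finally show ?thesis using u by (auto simp: C_def)
    qed
    show "k x \<le> k z" if k: "k \<in> C" and x: "x \<in> ?I" and z: "z \<in> ?I" and "x \<le> z" for k x z
    proof -
      obtain t where t: "t \<ge> 0" "k = h t" using k by (metis C_def atLeast_iff imageE)
      have "q (x + t *\<^sub>R y) \<le> q (z + t *\<^sub>R y)"
        using \<open>x \<le> z\<close> by (intro sup_sublinear_mono[OF q] cl x y z) simp
      then show ?thesis unfolding t h_def by simp
    qed
    have "h 0 \<in> C" by (simp add: C_def)
    then show "\<exists>q\<in>C. q e \<le> 1" "\<exists>q\<in>C. q (- e) \<le> -1" using qe by (auto simp: h_def)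
  qed
  moreover have rle: "r x \<le> h t x" if "x \<in> ?I" "t \<ge> 0" for x t
  proof -
    have "(INF q\<in>C. q x) \<le> h t x"
      using that bd[OF _ that(1)] by (intro cINF_lower bdd_belowI2) (auto simp: C_def)
    then show ?thesis using that by (simp add: r_def)
  qed
  have "r \<le> q"
  proof (rule le_funI)
    fix x show "r x \<le> q x" using rle[of x 0] qout[of x] by (cases "x \<in> ?I") (auto simp: h_def r_def)
  qed
  moreover have "r (- y) \<le> - q y" using rle[of "- y" 1] cl(3)[OF y] q0 by (simp add: h_def)
  ultimately show ?thesis by blast
qed

definition normalized_lattice_homs :: "'a::vector_lattice \<Rightarrow> ('a \<Rightarrow> real) set" where
  "normalized_lattice_homs e = {q. (\<forall>x. x \<notin> principal_ideal e \<longrightarrow> q x = 0) \<and>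
     (\<forall>x\<in>principal_ideal e. \<forall>y\<in>principal_ideal e. q (x + y) = q x + q y) \<and>
     (\<forall>x\<in>principal_ideal e. \<forall>c. q (c *\<^sub>R x) = c * q x) \<and>
     (\<forall>x\<in>principal_ideal e. \<forall>y\<in>principal_ideal e. q (sup x y) = max (q x) (q y)) \<and>
     q e = 1}"

lemma sup_sublinear_minimal:
  assumes e: "0 \<le> e" and q0: "q0 \<in> sup_sublinear e"
  shows "\<exists>q\<in>normalized_lattice_homs e. q \<le> q0"
proof -
  let ?I = "principal_ideal e"
  note cl = principal_ideal_closed[OF e]
  let ?A = "{q \<in> sup_sublinear e. q \<le> q0}"
  have "\<exists>m\<in>?A. \<forall>a\<in>?A. m \<ge> a \<longrightarrow> a = m"
  proof (rule predicate_Zorn)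
    show "partial_order_on ?A (relation_of (\<ge>) ?A)"
      by (rule partial_order_on_relation_ofI) auto
    fix C assume C: "C \<in> Chains (relation_of (\<ge>) ?A)"
    show "\<exists>u\<in>?A. \<forall>a\<in>C. u \<le> a"
    proof (cases "C = {}")
      case True then show ?thesis using q0 by auto
    next
      case False
      have CA: "C \<subseteq> ?A" and ch: "\<And>q1 q2. q1 \<in> C \<Longrightarrow> q2 \<in> C \<Longrightarrow> q1 \<le> q2 \<or> q2 \<le> q1"
        using C unfolding Chains_def relation_of_def by auto
      have dir: "\<exists>q\<in>C. q \<le> q1 \<and> q \<le> q2" if "q1 \<in> C" "q2 \<in> C" for q1 q2
        using ch[OF that] that by blast
      define r where "r = (\<lambda>x. if x \<in> ?I then INF q\<in>C. q x else 0)"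
      have bd: "- q0 (- x) \<le> q x" if "q \<in> C" "x \<in> ?I" for q x
        using sup_sublinear_neg[OF e _ that(2), of q] CA that(1) le_funD[of q q0 "- x"] by force
      have r: "r \<in> sup_sublinear e" unfolding r_def
      proof (rule sup_sublinear_INF[OF e False])
        show "\<exists>b. \<forall>q\<in>C. b \<le> q x" if "x \<in> ?I" for x using bd that by blast
        show "\<exists>q\<in>C. q (x + y) \<le> q1 x + q2 y" if q12: "q1 \<in> C" "q2 \<in> C" "x \<in> ?I" "y \<in> ?I" for q1 q2 x y
        proof -
          obtain q where q: "q \<in> C" "q \<le> q1" "q \<le> q2" using dir[OF q12(1,2)] by blast
          have "q (x + y) \<le> q x + q y" using q CA q12 unfolding sup_sublinear_def by blast
          then show ?thesis using q le_funD[OF q(2), of x] le_funD[OF q(3), of y] by (intro bexI[of _ q]) auto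
        qed
        show "\<exists>q'\<in>C. q' (c *\<^sub>R x) \<le> c * q x" if "q \<in> C" "c > 0" "x \<in> ?I" for q c x
          using CA that unfolding sup_sublinear_def by blast
        show "\<exists>q\<in>C. q (sup x y) \<le> max (q1 x) (q2 y)" if q12: "q1 \<in> C" "q2 \<in> C" "x \<in> ?I" "y \<in> ?I" for q1 q2 x y
        proof -
          obtain q where q: "q \<in> C" "q \<le> q1" "q \<le> q2" using dir[OF q12(1,2)] by blast
          have "q (sup x y) = max (q x) (q y)" using q CA q12 unfolding sup_sublinear_def by blast
          then show ?thesis using q le_funD[OF q(2), of x] le_funD[OF q(3), of y] by (intro bexI[of _ q]) auto
        qed
        show "q x \<le> q y" if "q \<in> C" "x \<in> ?I" "y \<in> ?I" "x \<le> y" for q x y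
          using sup_sublinear_mono CA that by blast
        show "\<exists>q\<in>C. q e \<le> 1" "\<exists>q\<in>C. q (- e) \<le> -1"
          using False CA unfolding sup_sublinear_def by blast+
      qed
      have rle: "r \<le> q" if q: "q \<in> C" for q
      proof (rule le_funI)
        fix x
        show "r x \<le> q x"
        proof (cases "x \<in> ?I")
          case True
          then show ?thesis using q bd[OF _ True] by (auto simp: r_def intro!: cINF_lower bdd_belowI2)
        next
          case False
          then have "q x = 0" using q CA unfolding sup_sublinear_def by blast
          then show ?thesis using False by (simp add: r_def)
        qed
      qed
      obtain q1 where "q1 \<in> C" using False by blast
      then have "r \<le> q0" using rle CA by (blast intro: order_trans)
      then show ?thesis using r rle by blast
    qed
  qed
  then obtain q where q: "q \<in> sup_sublinear e" "q \<le> q0"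
    and min: "\<And>r. r \<in> sup_sublinear e \<Longrightarrow> r \<le> q \<Longrightarrow> r = q" by (blast intro: order_trans)
  have qadd: "\<And>x y. x \<in> ?I \<Longrightarrow> y \<in> ?I \<Longrightarrow> q (x + y) \<le> q x + q y"
    and qhom: "\<And>c x. c > 0 \<Longrightarrow> x \<in> ?I \<Longrightarrow> q (c *\<^sub>R x) \<le> c * q x"
    and qsup: "\<And>x y. x \<in> ?I \<Longrightarrow> y \<in> ?I \<Longrightarrow> q (sup x y) = max (q x) (q y)"
    and qout: "\<And>x. x \<notin> ?I \<Longrightarrow> q x = 0"
    and qe: "q e \<le> 1" "q (- e) \<le> -1"
    using q unfolding sup_sublinear_def by blast+
  have neg: "q (- y) = - q y" if y: "y \<in> ?I" for y
  proof -
    obtain r where r: "r \<in> sup_sublinear e" "r \<le> q" "r (- y) \<le> - q y"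
      using sup_sublinear_shift[OF e q(1) y] by blast
    have "q (- y) \<le> - q y" using min[OF r(1,2)] r(3) by simp
    moreover have "- q (- y) \<le> q y" by (rule sup_sublinear_neg[OF e q(1) y])
    ultimately show ?thesis by simp
  qed
  have add: "q (x + y) = q x + q y" if x: "x \<in> ?I" and y: "y \<in> ?I" for x y
  proof (rule antisym)
    show "q (x + y) \<le> q x + q y" by (rule qadd[OF x y])
    have "q (- x + - y) \<le> q (- x) + q (- y)" by (intro qadd cl x y)
    moreover have "q (- x + - y) = - q (x + y)" using neg[OF cl(4)[OF x y]] by simp
    ultimately show "q x + q y \<le> q (x + y)" using neg[OF x] neg[OF y] by simp
  qed
  have hpos: "q (c *\<^sub>R x) = c * q x" if c: "c > 0" and x: "x \<in> ?I" for c x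
  proof (rule antisym)
    show "q (c *\<^sub>R x) \<le> c * q x" by (rule qhom[OF c x])
    have "q (inverse c *\<^sub>R (c *\<^sub>R x)) \<le> inverse c * q (c *\<^sub>R x)" using c by (intro qhom cl x) auto
    then show "c * q x \<le> q (c *\<^sub>R x)" using c by (simp add: field_simps)
  qed
  have hom: "q (c *\<^sub>R x) = c * q x" if x: "x \<in> ?I" for c x
  proof -
    consider "c > 0" | "c = 0" | "- c > 0" by linarith
    then show ?thesis
    proof cases
      case 3
      have "q ((- c) *\<^sub>R x) = (- c) * q x" by (rule hpos[OF 3 x])
      then show ?thesis using neg[OF cl(5)[OF x, of c]] by simp
    qed (use hpos[OF _ x] sup_sublinear_zero[OF e q(1)] in auto)
  qed
  have "q e = 1" using qe neg[OF cl(1)] by simp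
  then have "q \<in> normalized_lattice_homs e"
    unfolding normalized_lattice_homs_def using qout add hom qsup by blast
  then show ?thesis using q(2) by blast
qed

lemma normalized_lattice_homs_separate:
  fixes e :: "'a::vector_lattice"
  assumes arch: "archimedean_vl TYPE('a)" and e: "0 \<le> e"
    and z: "z \<in> principal_ideal e" and nz: "z \<noteq> 0"
  shows "\<exists>q\<in>normalized_lattice_homs e. q z \<noteq> 0"
proof -
  let ?I = "principal_ideal e"
  note cl = principal_ideal_closed[OF e]
  note I = principal_ideal_iff[OF e]
  have epos: "e \<noteq> 0" using z nz I[of z] by (auto dest: antisym)
  have coef: "a \<le> b" if "a *\<^sub>R e \<le> b *\<^sub>R e" for a b
  proof (rule ccontr)
    assume "\<not> a \<le> b"
    then have "a - b > 0" by simp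
    moreover have "(a - b) *\<^sub>R e \<le> 0" using that by (simp add: algebra_simps)
    ultimately have "inverse (a - b) *\<^sub>R ((a - b) *\<^sub>R e) \<le> inverse (a - b) *\<^sub>R 0"
      by (intro scaleR_left_mono) auto
    then have "e \<le> 0" using \<open>a - b > 0\<close> by simp
    then show False using e epos by simp
  qed
  define p where "p = (\<lambda>x. if x \<in> ?I then Inf {a. x \<le> a *\<^sub>R e} else 0)"
  have up: "\<exists>a. x \<le> a *\<^sub>R e" if "x \<in> ?I" for x using that I by blast
  have lo: "\<exists>b. \<forall>a. x \<le> a *\<^sub>R e \<longrightarrow> b \<le> a" if "x \<in> ?I" for x
  proof -
    obtain b where "- (b *\<^sub>R e) \<le> x" using \<open>x \<in> ?I\<close> I by blast
    then have "- b \<le> a" if "x \<le> a *\<^sub>R e" for a using that coef[of "- b" a] by (simp add: order_trans)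
    then show ?thesis by blast
  qed
  have ple: "p x \<le> a" if x: "x \<in> ?I" and xa: "x \<le> a *\<^sub>R e" for x a
  proof -
    obtain b where "\<forall>a. x \<le> a *\<^sub>R e \<longrightarrow> b \<le> a" using lo[OF x] by blast
    then have "Inf {a. x \<le> a *\<^sub>R e} \<le> a"
      using xa by (intro cInf_lower bdd_belowI[of _ b]) auto
    then show ?thesis using x by (simp add: p_def)
  qed
  have pge: "b \<le> p x" if "x \<in> ?I" "\<And>a. x \<le> a *\<^sub>R e \<Longrightarrow> b \<le> a" for x b
    using that up[of x] by (auto simp: p_def intro!: cInf_greatest)
  have pless: "\<exists>a<b. x \<le> a *\<^sub>R e" if "x \<in> ?I" "p x < b" for x b
    using pge[of x b] that by (meson not_less)
  have mono: "x \<le> b *\<^sub>R e" if "x \<le> a *\<^sub>R e" "a \<le> b" for x a b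
    using that(1) scaleR_right_mono[OF that(2) e] by (rule order_trans)
  have p: "p \<in> sup_sublinear e"
    unfolding sup_sublinear_def
  proof (intro CollectI conjI ballI allI impI)
    show "p x = 0" if "x \<notin> ?I" for x using that by (simp add: p_def)
    show "p (x + y) \<le> p x + p y" if x: "x \<in> ?I" and y: "y \<in> ?I" for x y
    proof -
      have "p (x + y) - b \<le> p x" if b: "y \<le> b *\<^sub>R e" for b
      proof (rule pge[OF x])
        fix a assume a: "x \<le> a *\<^sub>R e"
        have "x + y \<le> (a + b) *\<^sub>R e" using add_mono[OF a b] by (simp add: scaleR_left_distrib)
        then show "p (x + y) - b \<le> a" using ple[OF cl(4)[OF x y]] by force
      qed
      then have "p (x + y) - p x \<le> p y" by (intro pge[OF y]) force
      then show ?thesis by simp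
    qed
    show "p (c *\<^sub>R x) \<le> c * p x" if c: "c > 0" and x: "x \<in> ?I" for c x
    proof -
      have "p (c *\<^sub>R x) / c \<le> p x"
      proof (rule pge[OF x])
        fix a assume "x \<le> a *\<^sub>R e"
        then have "c *\<^sub>R x \<le> (c * a) *\<^sub>R e" using scaleR_left_mono[of x "a *\<^sub>R e" c] c by simp
        then show "p (c *\<^sub>R x) / c \<le> a" using ple[OF cl(5)[OF x]] c by (simp add: field_simps)
      qed
      then show ?thesis using c by (simp add: field_simps)
    qed
    show "p (sup x y) = max (p x) (p y)" if x: "x \<in> ?I" and y: "y \<in> ?I" for x y
    proof (rule antisym)
      show "max (p x) (p y) \<le> p (sup x y)"
        using ple[OF x] ple[OF y] by (intro pge[OF cl(6)[OF x y]]) auto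
      show "p (sup x y) \<le> max (p x) (p y)"
      proof (rule ccontr)
        assume "\<not> ?thesis"
        then obtain a b where "a < p (sup x y)" "x \<le> a *\<^sub>R e" "b < p (sup x y)" "y \<le> b *\<^sub>R e"
          using pless[OF x, of "p (sup x y)"] pless[OF y, of "p (sup x y)"] by (auto simp: not_le)
        then have "p (sup x y) \<le> max a b" "max a b < p (sup x y)"
          using mono[of x a "max a b"] mono[of y b "max a b"] by (auto intro!: ple[OF cl(6)[OF x y]])
        then show False by simp
      qed
    qed
    show "p e \<le> 1" by (rule ple[OF cl(1)]) simp
    show "p (- e) \<le> -1" by (rule ple[OF cl(3)[OF cl(1)]]) simp
  qed
  define w where "w = \<bar>z\<bar>"
  have w: "w \<in> ?I" unfolding w_def abs_lattice by (intro cl z)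
  have pw: "p w > 0"
  proof (rule ccontr)
    assume *: "\<not> p w > 0"
    have "real n *\<^sub>R w \<le> e" for n
    proof (cases "n = 0")
      case False
      then have "p w < 1 / real n" using * by (smt (verit) of_nat_0_less_iff divide_pos_pos neq0_conv)
      then obtain a where "a < 1 / real n" "w \<le> a *\<^sub>R e" using pless[OF w] by blast
      then have "w \<le> (1 / real n) *\<^sub>R e" using mono by force
      then have "real n *\<^sub>R w \<le> real n *\<^sub>R ((1 / real n) *\<^sub>R e)" by (intro scaleR_left_mono) auto
      then show ?thesis using False by simp
    qed (use e in simp)
    then have "w \<le> 0" using arch unfolding archimedean_vl_def by blast
    then show False using nz by (simp add: w_def)
  qed
  obtain r where r: "r \<in> sup_sublinear e" "r (- w) \<le> - p w"
    using sup_sublinear_shift[OF e p w] by blast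
  obtain q where q: "q \<in> normalized_lattice_homs e" "q \<le> r"
    using sup_sublinear_minimal[OF e r(1)] by blast
  have hom: "\<And>x c. x \<in> ?I \<Longrightarrow> q (c *\<^sub>R x) = c * q x"
    and sup: "\<And>x y. x \<in> ?I \<Longrightarrow> y \<in> ?I \<Longrightarrow> q (sup x y) = max (q x) (q y)"
    using q(1) unfolding normalized_lattice_homs_def by blast+
  have "q (- w) < 0" using le_funD[OF q(2), of "- w"] r(2) pw by linarith
  then have "q w > 0" using hom[OF w, of "- 1"] by simp
  moreover have "q w = max (q z) (- q z)"
    unfolding w_def abs_lattice using sup[OF z cl(3)[OF z]] hom[OF z, of "- 1"] by simp
  ultimately have "q z \<noteq> 0" by auto
  then show ?thesis using q(1) by blast
qed

lemma lattice_approx_above: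
  assumes K: "compact_space K"
    and cont: "\<And>g. g \<in> L \<Longrightarrow> continuous_map K euclideanreal g"
    and f: "continuous_map K euclideanreal f"
    and inf: "\<And>g h. g \<in> L \<Longrightarrow> h \<in> L \<Longrightarrow> (\<lambda>t. min (g t) (h t)) \<in> L"
    and ne: "L \<noteq> {}"
    and pt: "\<And>s. s \<in> topspace K \<Longrightarrow> \<exists>g\<in>L. g s < f s + \<epsilon>"
  shows "\<exists>g\<in>L. \<forall>s\<in>topspace K. g s < f s + \<epsilon>"
proof -
  define U where "U = (\<lambda>g. {t \<in> topspace K. g t < f t + \<epsilon>})"
  have op: "openin K (U g)" if "g \<in> L" for g
  proof -
    have "continuous_map K euclideanreal (\<lambda>t. f t + \<epsilon> - g t)"
      by (intro continuous_intros f cont that) auto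
    then have "openin K {t \<in> topspace K. f t + \<epsilon> - g t \<in> {0<..}}"
      by (rule openin_continuous_map_preimage) auto
    then show ?thesis by (simp add: U_def algebra_simps)
  qed
  have "\<exists>\<F>. finite \<F> \<and> \<F> \<subseteq> U ` L \<and> topspace K \<subseteq> \<Union>\<F>"
    using K op pt unfolding compact_space_alt by (elim allE[of _ "U ` L"]) (auto simp: U_def)
  then obtain G where G: "finite G" "G \<subseteq> L" "topspace K \<subseteq> (\<Union>g\<in>G. U g)"
    by (metis finite_subset_image)
  have "\<exists>g\<in>L. \<forall>h\<in>G. \<forall>t. g t \<le> h t" using G(1,2)
  proof (induction G rule: finite_induct)
    case empty then show ?case using ne by auto
  next
    case (insert k G)
    then obtain g where "g \<in> L" "\<forall>h\<in>G. \<forall>t. g t \<le> h t" by auto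
    then show ?case using insert inf[of g k]
      by (intro bexI[of _ "\<lambda>t. min (g t) (k t)"]) (auto simp: min.coboundedI1)
  qed
  then obtain g where g: "g \<in> L" "\<And>h t. h \<in> G \<Longrightarrow> g t \<le> h t" by blast
  have "g s < f s + \<epsilon>" if s: "s \<in> topspace K" for s
  proof -
    obtain h where "h \<in> G" "s \<in> U h" using G(3) s by blast
    then show ?thesis using g(2)[of h s] by (simp add: U_def)
  qed
  then show ?thesis using g(1) by blast
qed

lemma lattice_Stone_Weierstrass:
  assumes K: "compact_space K" and L: "vector_sublattice K L"
    and interp: "\<And>f s t. s \<in> topspace K \<Longrightarrow> t \<in> topspace K \<Longrightarrow> f \<in> cont_funs K \<Longrightarrow>
        \<exists>g\<in>L. g s = f s \<and> g t = f t"
  shows "norm_dense K L"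
  unfolding norm_dense_def
proof (intro ballI allI impI)
  fix f and \<epsilon> :: real assume f: "f \<in> cont_funs K" and \<epsilon>: "\<epsilon> > 0"
  have fc: "continuous_map K euclideanreal f" using f by (simp add: cont_funs_def)
  have Lc: "\<And>g. g \<in> L \<Longrightarrow> continuous_map K euclideanreal g"
    and mx: "\<And>g h. g \<in> L \<Longrightarrow> h \<in> L \<Longrightarrow> (\<lambda>t. max (g t) (h t)) \<in> L"
    and mn: "\<And>g h. g \<in> L \<Longrightarrow> h \<in> L \<Longrightarrow> (\<lambda>t. min (g t) (h t)) \<in> L"
    and L0: "(\<lambda>t. 0) \<in> L"
    using L by (auto simp: vector_sublattice_def cont_funs_def)
  have above: "\<exists>g\<in>L. g t = f t \<and> (\<forall>s\<in>topspace K. g s < f s + \<epsilon>)" if t: "t \<in> topspace K" for t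
  proof -
    have "\<exists>g\<in>{g \<in> L. g t = f t}. \<forall>s\<in>topspace K. g s < f s + \<epsilon>"
    proof (rule lattice_approx_above[OF K _ fc])
      show "{g \<in> L. g t = f t} \<noteq> {}" using interp[OF t t f] by blast
      show "\<exists>g\<in>{g \<in> L. g t = f t}. g s < f s + \<epsilon>" if "s \<in> topspace K" for s
        using interp[OF that t f] \<epsilon> by auto
    qed (auto simp: Lc mn)
    then show ?thesis by blast
  qed
  let ?M = "{g. (\<lambda>t. - g t) \<in> L \<and> (\<forall>s\<in>topspace K. - g s < f s + \<epsilon>)}"
  have Mne: "?M \<noteq> {}"
  proof (cases "topspace K = {}")
    case True then show ?thesis using L0 by (auto intro!: exI[of _ "\<lambda>t. 0"])
  next
    case False
    then obtain g where "g \<in> L" "\<forall>s\<in>topspace K. g s < f s + \<epsilon>" using above by blast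
    then show ?thesis by (auto intro!: exI[of _ "\<lambda>t. - g t"])
  qed
  have "\<exists>g\<in>?M. \<forall>s\<in>topspace K. g s < - f s + \<epsilon>"
  proof (rule lattice_approx_above[OF K _ _ _ Mne])
    show "continuous_map K euclideanreal g" if "g \<in> ?M" for g
    proof -
      have "(\<lambda>t. - g t) \<in> L" using that by blast
      from continuous_map_minus[OF Lc[OF this]] show ?thesis by simp
    qed
    show "continuous_map K euclideanreal (\<lambda>t. - f t)" using fc by (rule continuous_map_minus)
    show "(\<lambda>t. min (g t) (h t)) \<in> ?M" if "g \<in> ?M" "h \<in> ?M" for g h
    proof -
      have "(\<lambda>t. max (- g t) (- h t)) \<in> L" using that mx by blast
      moreover have "(\<lambda>t. - min (g t) (h t)) = (\<lambda>t. max (- g t) (- h t))" by (auto simp: min_def max_def)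
      ultimately show ?thesis using that by (auto simp: min_def)
    qed
    show "\<exists>g\<in>?M. g s < - f s + \<epsilon>" if "s \<in> topspace K" for s
    proof -
      obtain g where "g \<in> L" "g s = f s" "\<forall>s\<in>topspace K. g s < f s + \<epsilon>" using above \<open>s \<in> topspace K\<close> by blast
      then show ?thesis using \<epsilon> by (intro bexI[of _ "\<lambda>t. - g t"]) auto
    qed
  qed
  then obtain g where g: "(\<lambda>t. - g t) \<in> L" "\<forall>s\<in>topspace K. - g s < f s + \<epsilon>" "\<forall>s\<in>topspace K. g s < - f s + \<epsilon>"
    by blast
  show "\<exists>g\<in>L. \<forall>t\<in>topspace K. \<bar>f t - g t\<bar> < \<epsilon>"
    using g by (intro bexI[of _ "\<lambda>t. - g t"]) (auto simp: abs_less_iff algebra_simps)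
qed

text \<open>
  Every \<open>e \<ge> 0\<close> has a spectrum carried by the type \<open>'a \<Rightarrow> real\<close>; statements about an arbitrary
  choice of spectra are therefore not vacuous.
\<close>

theorem krein_kakutani:
  fixes e :: "'a::vector_lattice"
  assumes arch: "archimedean_vl TYPE('a)" and e: "0 \<le> e"
  shows "\<exists>K :: ('a \<Rightarrow> real) topology. krein_kakutani_spectrum e K"
proof -
  let ?I = "principal_ideal e"
  let ?X = "normalized_lattice_homs e"
  define K :: "('a \<Rightarrow> real) topology" where "K = top_of_set ?X"
  note cl = principal_ideal_closed[OF e]
  have Xadd: "\<And>q x y. q \<in> ?X \<Longrightarrow> x \<in> ?I \<Longrightarrow> y \<in> ?I \<Longrightarrow> q (x + y) = q x + q y"
    and Xhom: "\<And>q x c. q \<in> ?X \<Longrightarrow> x \<in> ?I \<Longrightarrow> q (c *\<^sub>R x) = c * q x"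
    and Xsup: "\<And>q x y. q \<in> ?X \<Longrightarrow> x \<in> ?I \<Longrightarrow> y \<in> ?I \<Longrightarrow> q (sup x y) = max (q x) (q y)"
    and Xout: "\<And>q x. q \<in> ?X \<Longrightarrow> x \<notin> ?I \<Longrightarrow> q x = 0"
    and Xe: "\<And>q. q \<in> ?X \<Longrightarrow> q e = 1"
    unfolding normalized_lattice_homs_def by blast+
  have Xinf: "q (inf x y) = min (q x) (q y)" if "q \<in> ?X" "x \<in> ?I" "y \<in> ?I" for q x y
  proof -
    have neg: "q (- z) = - q z" if "z \<in> ?I" for z using Xhom[OF \<open>q \<in> ?X\<close> that, of "- 1"] by simp
    have "inf x y = - sup (- x) (- y)" by (simp add: neg_sup_eq_inf)
    then have "q (inf x y) = - q (sup (- x) (- y))" using neg[OF cl(6)[OF cl(3) cl(3)]] that by simp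
    also have "\<dots> = - max (- q x) (- q y)" using that neg by (simp add: Xsup cl)
    finally have "q (inf x y) = - max (- q x) (- q y)" .
    then show ?thesis by (simp add: min_def max_def)
  qed
  have Xmono: "q x \<le> q y" if "q \<in> ?X" "x \<in> ?I" "y \<in> ?I" "x \<le> y" for q x y
    using Xsup[OF that(1-3)] that(4) by (simp add: sup_absorb2)
  have "\<exists>b. \<forall>q\<in>?X. q x \<in> {- b..b}" for x
  proof (cases "x \<in> ?I")
    case True
    then obtain a where a: "- (a *\<^sub>R e) \<le> x" "x \<le> a *\<^sub>R e" using principal_ideal_iff[OF e] by blast
    have "q x \<in> {- a..a}" if q: "q \<in> ?X" for q
    proof -
      have "(- a) *\<^sub>R e \<le> x" using a by simp
      have "q ((- a) *\<^sub>R e) \<le> q x" "q x \<le> q (a *\<^sub>R e)"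
        by (rule Xmono[OF q cl(5)[OF cl(1)] True \<open>(- a) *\<^sub>R e \<le> x\<close>],
            rule Xmono[OF q True cl(5)[OF cl(1)] a(2)])
      then show ?thesis
        unfolding Xhom[OF q cl(1)] Xe[OF q] by simp
    qed
    then show ?thesis by blast
  next
    case False
    have "\<forall>q\<in>?X. q x \<in> {- 0..0}" using Xout[OF _ False] by simp
    then show ?thesis by blast
  qed
  then obtain b where b: "\<And>x q. q \<in> ?X \<Longrightarrow> q x \<in> {- b x..b x}" by metis
  have "compactin (product_topology (\<lambda>_. euclideanreal) UNIV) (\<Pi>\<^sub>E x\<in>UNIV. {- b x..b x})"
    unfolding compactin_PiE by auto
  then have cbox: "compactin euclidean (\<Pi>\<^sub>E x\<in>UNIV. {- b x..b x})"
    unfolding euclidean_product_topology .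
  have "?X = {q. \<forall>x. x \<notin> ?I \<longrightarrow> q x = 0} \<inter> {q. \<forall>x y. x \<in> ?I \<longrightarrow> y \<in> ?I \<longrightarrow> q (x + y) = q x + q y} \<inter>
     {q. \<forall>x c. x \<in> ?I \<longrightarrow> q (c *\<^sub>R x) = c * q x} \<inter>
     {q. \<forall>x y. x \<in> ?I \<longrightarrow> y \<in> ?I \<longrightarrow> q (sup x y) = max (q x) (q y)} \<inter> {q. q e = 1}"
    unfolding normalized_lattice_homs_def by blast
  moreover have "closed \<dots>"
    by (intro closed_Int closed_Collect_all closed_Collect_imp open_Collect_const closed_Collect_eq
        continuous_intros continuous_on_product_coordinates)
  ultimately have "closed ?X" by simp
  then have "compactin euclidean ?X"
    using cbox b by (intro closed_compactin[OF cbox]) auto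
  then have compK: "compact_space K" unfolding K_def by (simp add: compact_space_subtopology)
  have "Hausdorff_space (product_topology (\<lambda>_::'a. euclideanreal) UNIV)"
    by (simp add: Hausdorff_space_product_topology)
  then have hausK: "Hausdorff_space K" unfolding K_def euclidean_product_topology
    by (rule Hausdorff_space_subtopology)
  define T where "T = (\<lambda>x q. if q \<in> ?X then q x else 0 :: real)"
  define L where "L = T ` ?I"
  have top: "topspace K = ?X" by (simp add: K_def)
  have Tadd: "T (x + y) = (\<lambda>t. T x t + T y t)" if "x \<in> ?I" "y \<in> ?I" for x y
    using Xadd that by (auto simp: T_def)
  have Thom: "T (c *\<^sub>R x) = (\<lambda>t. c * T x t)" if "x \<in> ?I" for x c
    using Xhom that by (auto simp: T_def)
  have Tsup: "T (sup x y) = (\<lambda>t. max (T x t) (T y t))" if "x \<in> ?I" "y \<in> ?I" for x y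
    using Xsup that by (auto simp: T_def)
  have Tinf: "T (inf x y) = (\<lambda>t. min (T x t) (T y t))" if "x \<in> ?I" "y \<in> ?I" for x y
    using Xinf that by (auto simp: T_def)
  have inj: "inj_on T ?I"
  proof (rule inj_onI, rule ccontr)
    fix x y assume x: "x \<in> ?I" and y: "y \<in> ?I" and eq: "T x = T y" and "x \<noteq> y"
    have "x + (- 1) *\<^sub>R y \<in> ?I" by (intro cl x y)
    moreover have "x + (- 1) *\<^sub>R y \<noteq> 0" using \<open>x \<noteq> y\<close> by simp
    ultimately obtain q where q: "q \<in> ?X" "q (x + (- 1) *\<^sub>R y) \<noteq> 0"
      using normalized_lattice_homs_separate[OF arch e] by blast
    then have "q x \<noteq> q y" using Xadd[OF q(1) x cl(5)[OF y, of "- 1"]] Xhom[OF q(1) y, of "- 1"] by simp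
    then show False using fun_cong[OF eq, of q] q(1) by (simp add: T_def)
  qed
  have iso: "vl_isomorphism T ?I L"
    unfolding vl_isomorphism_def L_def bij_betw_def
    by (intro conjI ballI allI inj refl Tadd Thom Tsup Tinf)
  have Tc: "T x \<in> cont_funs K" for x
  proof -
    have "continuous_on ?X (T x) \<longleftrightarrow> continuous_on ?X (\<lambda>q. q x)"
      by (rule continuous_on_cong) (auto simp: T_def)
    moreover have "continuous_on ?X (\<lambda>q. q x)"
      by (rule continuous_on_subset[OF continuous_on_product_coordinates]) simp
    ultimately show ?thesis by (simp add: cont_funs_def K_def T_def)
  qed
  have sub: "vector_sublattice K L"
    unfolding vector_sublattice_def
  proof (intro conjI ballI allI)
    show "L \<subseteq> cont_funs K" using Tc by (auto simp: L_def)
    have "T (0 *\<^sub>R e) \<in> L" unfolding L_def by (intro imageI cl)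
    then show "(\<lambda>t. 0) \<in> L" using Thom[OF cl(1), of 0] by simp
    fix f g assume "f \<in> L" "g \<in> L"
    then obtain x y where xy: "x \<in> ?I" "y \<in> ?I" "f = T x" "g = T y" by (auto simp: L_def)
    show "(\<lambda>t. f t + g t) \<in> L"
      unfolding L_def xy(3,4) Tadd[OF xy(1,2), symmetric] by (intro imageI cl xy)
    show "(\<lambda>t. max (f t) (g t)) \<in> L"
      unfolding L_def xy(3,4) Tsup[OF xy(1,2), symmetric] by (intro imageI cl xy)
    show "(\<lambda>t. min (f t) (g t)) \<in> L"
      unfolding L_def xy(3,4) Tinf[OF xy(1,2), symmetric] by (intro imageI cl xy)
  next
    fix f c assume "f \<in> L"
    then obtain x where x: "x \<in> ?I" "f = T x" by (auto simp: L_def)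
    show "(\<lambda>t. c * f t) \<in> L"
      unfolding L_def x(2) Thom[OF x(1), symmetric] by (intro imageI cl x)
  qed
  have dense: "norm_dense K L"
  proof (rule lattice_Stone_Weierstrass[OF compK sub])
    fix f s t assume "s \<in> topspace K" "t \<in> topspace K"
    then have s: "s \<in> ?X" and t: "t \<in> ?X" by (auto simp: top)
    show "\<exists>g\<in>L. g s = f s \<and> g t = f t"
    proof (cases "s = t")
      case True
      have "T (f s *\<^sub>R e) s = f s" using s Xhom[OF s cl(1)] Xe[OF s] by (simp add: T_def)
      then show ?thesis using True cl(5)[OF cl(1)] unfolding L_def by blast
    next
      case False
      then obtain x where ne: "s x \<noteq> t x" by blast
      then have x: "x \<in> ?I" using Xout[OF s, of x] Xout[OF t, of x] by force
      define \<beta> where "\<beta> = (f s - f t) / (s x - t x)"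
      define y where "y = \<beta> *\<^sub>R x + (f s - \<beta> * s x) *\<^sub>R e"
      have y: "y \<in> ?I" unfolding y_def by (intro cl x)
      have val: "q y = \<beta> * q x + (f s - \<beta> * s x)" if q: "q \<in> ?X" for q
        unfolding y_def using q x Xe[OF q] by (simp add: Xadd Xhom cl)
      have "\<beta> * (s x - t x) = f s - f t" using ne by (simp add: \<beta>_def)
      then have "t y = f t" "s y = f s" using val[OF s] val[OF t] by (auto simp: algebra_simps)
      then show ?thesis using y s t unfolding L_def by (intro bexI[of _ "T y"]) (auto simp: T_def)
    qed
  qed
  show ?thesis
    unfolding krein_kakutani_spectrum_def using compK hausK iso sub dense by blast
qed

end

theory Submission
  imports Defs
begin

text \<open>
  Fix \<open>e \<ge> 0\<close>, write \<open>I\<^sub>e\<close> for the ideal it generates, and let \<open>T\<close> represent \<open>I\<^sub>e\<close> as a dense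
  sublattice of \<open>C(K)\<close> with \<open>K\<close> the spectrum.  The proof translates decompositions of \<open>e\<close> into clopen
  subsets of \<open>K\<close>.  For a set \<open>S\<close> of elements of \<open>I\<^sub>e\<close> let \<open>U\<close> be the union of the cozero sets of \<open>T x\<close>,
  \<open>x \<in> S\<close>.

  From projections to clopen sets: let \<open>B\<close> be a projection band between \<open>S\<close> and its double disjoint
  complement, and \<open>e = b + c\<close> the corresponding decomposition.  Since \<open>b\<close> and \<open>c\<close> are disjoint and
  \<open>T e\<close> has no zero, the cozero sets of \<open>b\<close> and \<open>c\<close> partition \<open>K\<close> into two clopen pieces.  The piece
  of \<open>b\<close> contains \<open>U\<close>, and \<open>U\<close> is dense in it, because a bump function supported in the remainder
  would be disjoint from \<open>S\<close> but not from \<open>b\<close>.  Hence the closure of \<open>U\<close> is open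
  (\<open>openin_closure_if_projection_band\<close>).  Every open set is such a \<open>U\<close>, and every cozero set is such
  a \<open>U\<close> for a countable \<open>S\<close>; this gives both forward implications.

  From clopen sets to projections: let \<open>B\<close> be a band and \<open>U\<close> the union of the cozero sets of the
  elements of \<open>B \<inter> I\<^sub>e\<close>.  If the closure \<open>V\<close> of \<open>U\<close> is open, then the restriction of \<open>T e\<close> to \<open>V\<close>,
  extended by zero, is again in the range of \<open>T\<close>, although that range need not be all of \<open>C(K)\<close>: it
  is \<open>T (e \<sqinter> M x)\<close> for a large multiple \<open>M x\<close> of an element \<open>x\<close> whose image is at least 1 on \<open>V\<close>
  and zero elsewhere.  The element \<open>b = e \<sqinter> M x\<close> is the supremum of the elements of \<open>B\<close> in \<open>[0, b]\<close>,
  so it lies in \<open>B\<close>, and \<open>e - b\<close> is disjoint from \<open>B\<close> (\<open>decomposition_if_openin_closure\<close>).  When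
  \<open>B\<close> is generated by a countable set \<open>S\<close>, the set \<open>U\<close> need not be a cozero set, but it has the same
  closure as the union of the cozero sets of \<open>\<bar>s\<bar> \<sqinter> e\<close>, \<open>s \<in> S\<close>, which is one
  (\<open>closure_coz_generated_band\<close>).  Since \<open>e\<close> is arbitrary, \<open>B\<close> is a projection band.
\<close>

section \<open>Disjointness and bands in vector lattices\<close>

text \<open>
  A form of disjointness that needs no lattice identities: to bound a common minorant \<open>z\<close> of sums or
  multiples by zero, it suffices to shift or rescale \<open>z\<close>.
\<close>

lemma disjoint_iff:
  fixes x y :: "'a::vector_lattice"
  shows "inf \<bar>x\<bar> \<bar>y\<bar> = 0 \<longleftrightarrow> (\<forall>z. z \<le> \<bar>x\<bar> \<and> z \<le> \<bar>y\<bar> \<longrightarrow> z \<le> 0)"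
proof (rule iffI)
  assume "inf \<bar>x\<bar> \<bar>y\<bar> = 0"
  then show "\<forall>z. z \<le> \<bar>x\<bar> \<and> z \<le> \<bar>y\<bar> \<longrightarrow> z \<le> 0" by (metis le_inf_iff)
next
  assume "\<forall>z. z \<le> \<bar>x\<bar> \<and> z \<le> \<bar>y\<bar> \<longrightarrow> z \<le> 0"
  then have "inf \<bar>x\<bar> \<bar>y\<bar> \<le> 0" by (elim allE[of _ "inf \<bar>x\<bar> \<bar>y\<bar>"]) simp
  moreover have "0 \<le> inf \<bar>x\<bar> \<bar>y\<bar>" by simp
  ultimately show "inf \<bar>x\<bar> \<bar>y\<bar> = 0" by (rule order_antisym)
qed

lemma disjoint_complement_iff:
  "f \<in> disjoint_complement H \<longleftrightarrow> (\<forall>h\<in>H. \<forall>z. z \<le> \<bar>f\<bar> \<and> z \<le> \<bar>h\<bar> \<longrightarrow> z \<le> 0)"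
  by (auto simp: disjoint_complement_def disjoint_iff)

lemma abs_scaleR_le:
  fixes x :: "'a::vector_lattice"
  shows "\<bar>c *\<^sub>R x\<bar> \<le> \<bar>c\<bar> *\<^sub>R \<bar>x\<bar>"
proof -
  have *: "d *\<^sub>R x \<le> \<bar>d\<bar> *\<^sub>R \<bar>x\<bar>" for d
  proof (cases "d \<ge> 0")
    case True
    then show ?thesis using scaleR_left_mono[OF abs_ge_self[of x], of d] by simp
  next
    case False
    then have "(- d) *\<^sub>R (- x) \<le> (- d) *\<^sub>R \<bar>x\<bar>"
      by (intro scaleR_left_mono abs_ge_minus_self) auto
    then show ?thesis using False by simp
  qed
  from *[of c] *[of "- c"] show ?thesis by (intro abs_leI) auto
qed

lemma abs_prt_le:
  fixes x :: "'a::vector_lattice"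
  shows "\<bar>pprt x\<bar> \<le> \<bar>x\<bar>" "\<bar>nprt x\<bar> \<le> \<bar>x\<bar>"
proof -
  have "pprt x \<le> \<bar>x\<bar>" by (simp add: pprt_def abs_ge_self)
  then show "\<bar>pprt x\<bar> \<le> \<bar>x\<bar>" by simp
  have "- nprt x \<le> \<bar>x\<bar>"
    unfolding pprt_neg[symmetric] by (simp add: pprt_def abs_ge_minus_self)
  then show "\<bar>nprt x\<bar> \<le> \<bar>x\<bar>" by (metis abs_of_nonpos nprt_le_zero)
qed

text \<open>
  The negative part of \<open>b\<close> is dominated by \<open>c\<close>, hence by both members of a disjoint pair.
\<close>

lemma nonneg_if_disjoint_sum_nonneg:
  fixes b c :: "'a::vector_lattice"
  assumes "inf \<bar>b\<bar> \<bar>c\<bar> = 0" "0 \<le> b + c"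
  shows "0 \<le> b"
proof -
  have "- b \<le> c" using assms(2) by (metis add.commute diff_0 diff_le_eq)
  then have "- b \<le> \<bar>c\<bar>" using abs_ge_self by (rule order_trans)
  then have "- b \<le> inf \<bar>b\<bar> \<bar>c\<bar>" by (intro inf_greatest abs_ge_minus_self)
  then show ?thesis using assms(1) by simp
qed

lemma idealD:
  assumes "ideal E"
  shows "subspace E" "e \<in> E \<Longrightarrow> \<bar>f\<bar> \<le> \<bar>e\<bar> \<Longrightarrow> f \<in> E"
  using assms by (auto simp: ideal_def)

lemma bandD: "band B \<Longrightarrow> S \<subseteq> B \<Longrightarrow> isLub UNIV S s \<Longrightarrow> s \<in> B"
  by (auto simp: band_def)

lemma ideal_mem_of_prts:
  assumes "ideal E" "pprt x \<in> E" "nprt x \<in> E"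
  shows "x \<in> E"
  using subspace_add[OF idealD(1)[OF assms(1)] assms(2,3)] by (simp add: prts[symmetric])

lemma ideal_disjoint_complement: "ideal (disjoint_complement H)"
  unfolding ideal_def
proof (intro conjI allI impI)
  show "subspace (disjoint_complement H)"
  proof (rule subspaceI)
    show "0 \<in> disjoint_complement H" by (auto simp: disjoint_complement_iff)
  next
    fix x y assume x: "x \<in> disjoint_complement H" and y: "y \<in> disjoint_complement H"
    show "x + y \<in> disjoint_complement H"
      unfolding disjoint_complement_iff
    proof (intro ballI allI impI, elim conjE)
      fix h z assume h: "h \<in> H" and z: "z \<le> \<bar>x + y\<bar>" "z \<le> \<bar>h\<bar>"
      have "z \<le> \<bar>x\<bar> + \<bar>y\<bar>" using z(1) abs_triangle_ineq by (rule order_trans)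
      then have "z - \<bar>y\<bar> \<le> \<bar>x\<bar>" by (simp add: diff_le_eq)
      moreover have "z - \<bar>y\<bar> \<le> \<bar>h\<bar>" using z(2) by (simp add: diff_le_eq add_increasing2)
      ultimately have "z - \<bar>y\<bar> \<le> 0" using x h unfolding disjoint_complement_iff by blast
      then have "z \<le> \<bar>y\<bar>" by simp
      then show "z \<le> 0" using y h z unfolding disjoint_complement_iff by blast
    qed
  next
    fix c x assume x: "x \<in> disjoint_complement H"
    show "c *\<^sub>R x \<in> disjoint_complement H"
      unfolding disjoint_complement_iff
    proof (intro ballI allI impI, elim conjE)
      fix h z assume h: "h \<in> H" and z: "z \<le> \<bar>c *\<^sub>R x\<bar>" "z \<le> \<bar>h\<bar>"
      define m where "m = \<bar>c\<bar> + 1"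
      have m: "m \<ge> 1" "\<bar>c\<bar> \<le> m" by (auto simp: m_def)
      have "z \<le> m *\<^sub>R \<bar>x\<bar>"
        using z(1) abs_scaleR_le scaleR_right_mono[OF m(2) abs_ge_zero] by (metis order_trans)
      then have "inverse m *\<^sub>R z \<le> inverse m *\<^sub>R (m *\<^sub>R \<bar>x\<bar>)"
        using m by (intro scaleR_left_mono) auto
      then have 1: "inverse m *\<^sub>R z \<le> \<bar>x\<bar>" using m by simp
      have "inverse m *\<^sub>R z \<le> inverse m *\<^sub>R \<bar>h\<bar>" using m z by (intro scaleR_left_mono) auto
      also have "\<dots> \<le> 1 *\<^sub>R \<bar>h\<bar>"
        using m by (intro scaleR_right_mono abs_ge_zero) (simp add: inverse_le_1_iff)
      finally have "inverse m *\<^sub>R z \<le> \<bar>h\<bar>" by simp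
      with 1 have "inverse m *\<^sub>R z \<le> 0" using x h unfolding disjoint_complement_iff by blast
      then have "m *\<^sub>R (inverse m *\<^sub>R z) \<le> m *\<^sub>R 0" using m by (intro scaleR_left_mono) auto
      then show "z \<le> 0" using m by simp
    qed
  qed
next
  fix f e assume *: "e \<in> disjoint_complement H \<and> \<bar>f\<bar> \<le> \<bar>e\<bar>"
  then show "f \<in> disjoint_complement H"
    unfolding disjoint_complement_iff by (meson order_trans)
qed

text \<open>
  For \<open>s = sup S\<close> only \<open>s\<^sup>+\<close> is a matter of suprema, as \<open>s\<^sup>-\<close> is dominated by \<open>x\<^sup>-\<close> for any \<open>x \<in> S\<close>.
  If \<open>0 \<le> w \<le> s\<^sup>+\<close> and \<open>w \<le> \<bar>h\<bar>\<close> with \<open>h \<in> H\<close>, then each \<open>x\<^sup>+\<close> is disjoint from \<open>w\<close>, so that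
  \<open>x\<^sup>+ + w = x\<^sup>+ \<squnion> w \<le> s\<^sup>+\<close>.  Thus \<open>s - w\<close> is still an upper bound of \<open>S\<close>, which forces \<open>w = 0\<close>.
\<close>

lemma band_disjoint_complement: "band (disjoint_complement H)"
  unfolding band_def
proof (intro conjI allI impI ideal_disjoint_complement, elim conjE)
  fix S s assume S: "S \<subseteq> disjoint_complement H" and lub: "isLub UNIV S s"
  note le = isLubD2[OF lub]
  have least: "s \<le> u" if "\<And>x. x \<in> S \<Longrightarrow> x \<le> u" for u
    using isLub_le_isUb[OF lub isUb_UNIV_I] that by blast
  note dc = ideal_disjoint_complement[of H]
  show "s \<in> disjoint_complement H"
  proof (cases "S = {}")
    case True
    \<comment> \<open>Every element bounds the empty set, so its least upper bound is the least element.\<close>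
    have "s \<le> 0" "s \<le> s + s" by (rule least, use True in blast)+
    then have "s = 0" by (intro order_antisym) simp_all
    then show ?thesis using subspace_0[OF idealD(1)[OF dc]] by simp
  next
    case False
    then obtain x where x: "x \<in> S" by blast
    have "nprt x \<le> nprt s" by (rule nprt_mono[OF le[OF x]])
    then have "\<bar>nprt s\<bar> \<le> \<bar>nprt x\<bar>" by (simp add: abs_of_nonpos)
    then have "\<bar>nprt s\<bar> \<le> \<bar>x\<bar>" using abs_prt_le(2) by (rule order_trans)
    then have n: "nprt s \<in> disjoint_complement H" using idealD(2)[OF dc] S x by blast
    have p: "pprt s \<in> disjoint_complement H"
      unfolding disjoint_complement_iff
    proof (intro ballI allI impI, elim conjE)
      fix h z assume h: "h \<in> H" and z: "z \<le> \<bar>pprt s\<bar>" "z \<le> \<bar>h\<bar>"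
      define w where "w = pprt z"
      have w: "0 \<le> w" "w \<le> pprt s" "w \<le> \<bar>h\<bar>" using z by (auto simp: w_def pprt_def)
      have "x \<le> s - w" if x: "x \<in> S" for x
      proof -
        have "pprt x \<in> disjoint_complement H" using idealD(2)[OF dc _ abs_prt_le(1)] S x by blast
        then have "inf (pprt x) w \<le> 0" unfolding disjoint_complement_iff using h w
          by (metis abs_of_nonneg inf.coboundedI1 inf.coboundedI2 order_refl zero_le_pprt)
        then have "pprt x + w \<le> sup (pprt x) w"
          unfolding add_eq_inf_sup[of "pprt x" w] by simp
        also have "\<dots> \<le> pprt s" using w(2) pprt_mono[OF le[OF x]] by simp
        finally have "pprt x + nprt x + w \<le> pprt s + nprt s"
          using nprt_mono[OF le[OF x]] by (metis add.commute add.left_commute add_mono)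
        then show ?thesis by (simp add: prts[symmetric] le_diff_eq)
      qed
      then have "s \<le> s - w" by (rule least)
      then have "w \<le> 0" by simp
      then show "z \<le> 0" by (simp add: w_def pprt_def)
    qed
    show ?thesis using dc p n by (rule ideal_mem_of_prts)
  qed
qed

lemma band_Inter:
  assumes "\<And>B. B \<in> \<B> \<Longrightarrow> band B"
  shows "band (\<Inter>\<B>)"
proof -
  have "subspace (\<Inter>\<B>)" using assms by (intro subspace_Inter) (auto simp: band_def ideal_def)
  then show ?thesis using assms unfolding band_def ideal_def by blast
qed

lemma subset_double_disjoint_complement:
  "S \<subseteq> disjoint_complement (disjoint_complement S)"
  by (auto simp: disjoint_complement_def inf_commute)

lemma projection_band_iff_nonneg:
  assumes "ideal B"
  shows "projection_band B \<longleftrightarrow> (\<forall>e\<ge>0. \<exists>b\<in>B. \<exists>c\<in>disjoint_complement B. e = b + c)"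
proof
  assume "projection_band B"
  then show "\<forall>e\<ge>0. \<exists>b\<in>B. \<exists>c\<in>disjoint_complement B. e = b + c"
    unfolding projection_band_def by blast
next
  assume R: "\<forall>e\<ge>0. \<exists>b\<in>B. \<exists>c\<in>disjoint_complement B. e = b + c"
  have "\<exists>b\<in>B. \<exists>c\<in>disjoint_complement B. x = b + c" for x
  proof -
    obtain b c where 1: "b \<in> B" "c \<in> disjoint_complement B" "pprt x = b + c"
      using R zero_le_pprt by metis
    obtain b' c' where 2: "b' \<in> B" "c' \<in> disjoint_complement B" "- nprt x = b' + c'"
      using R nprt_le_zero by (metis neg_0_le_iff_le)
    have "x = pprt x - (- nprt x)" by (simp add: prts[symmetric])
    then have "x = (b - b') + (c - c')" unfolding 1(3) 2(3) by simp
    moreover have "b - b' \<in> B" "c - c' \<in> disjoint_complement B"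
      using 1 2 assms ideal_disjoint_complement by (auto intro: subspace_diff idealD(1))
    ultimately show ?thesis by blast
  qed
  then show "projection_band B" unfolding projection_band_def using assms by blast
qed

section \<open>Cozero sets\<close>

text \<open>
  The union of the cozero sets of \<open>f\<^sub>n\<close> is the cozero set of \<open>\<Sum>n. (1/2)^n min \<bar>f\<^sub>n\<bar> 1\<close>, which converges
  uniformly.
\<close>

lemma cozero_set_in_UN:
  assumes "countable A" and coz: "\<And>i. i \<in> A \<Longrightarrow> cozero_set_in X (U i)"
  shows "cozero_set_in X (\<Union>i\<in>A. U i)"
proof (cases "A = {}")
  case True
  then show ?thesis by (auto simp: cozero_set_in_def intro!: exI[of _ "\<lambda>_. 0"])
next
  case False
  have "\<forall>i\<in>A. \<exists>f. continuous_map X euclideanreal f \<and> U i = {x \<in> topspace X. f x \<noteq> 0}"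
    using coz by (simp add: cozero_set_in_def)
  then obtain f where f: "\<And>i. i \<in> A \<Longrightarrow> continuous_map X euclideanreal (f i)"
    "\<And>i. i \<in> A \<Longrightarrow> U i = {x \<in> topspace X. f i x \<noteq> 0}" by metis
  define k where "k = from_nat_into A"
  have k: "k n \<in> A" "range k = A" for n
    using False assms(1) by (auto simp: k_def from_nat_into range_from_nat_into)
  define g where "g n x = (1/2)^n * min \<bar>f (k n) x\<bar> 1" for n x
  have g: "\<bar>g n x\<bar> \<le> (1/2)^n" "0 \<le> g n x" "g n x = 0 \<longleftrightarrow> f (k n) x = 0" for n x
    by (auto simp: g_def abs_mult min_def mult_left_le)
  have summ: "summable (\<lambda>n. g n x)" for x
    by (rule summable_comparison_test'[of "\<lambda>n. (1/2)^n"]) (use g in auto)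
  have "uniform_limit (topspace X) (\<lambda>n x. \<Sum>i<n. g i x) (\<lambda>x. \<Sum>i. g i x) sequentially"
    by (rule Weierstrass_m_test[of _ _ "\<lambda>n. (1/2)^n"]) (use g in auto)
  then have "continuous_map X Met_TC.mtopology (\<lambda>x. \<Sum>i. g i x)"
    by (intro Met_TC.continuous_map_uniform_limit[where F=sequentially and f="\<lambda>n x. \<Sum>i<n. g i x"])
      (auto simp: uniform_limit_iff g_def intro!: continuous_intros f k always_eventually)
  then have "continuous_map X euclideanreal (\<lambda>x. \<Sum>i. g i x)" by simp
  moreover have "(\<Sum>i. g i x) = 0 \<longleftrightarrow> (\<forall>i\<in>A. f i x = 0)" for x
    using suminf_eq_zero_iff[OF summ g(2)] g(3) k by (metis (no_types, lifting) rangeE rangeI)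
  then have "(\<Union>i\<in>A. U i) = {x \<in> topspace X. (\<Sum>i. g i x) \<noteq> 0}" using f(2) by auto
  ultimately show ?thesis unfolding cozero_set_in_def by blast
qed

section \<open>The representation of a principal ideal by continuous functions\<close>

locale krein_kakutani_representation =
  fixes e :: "'a::vector_lattice" and K :: "'k topology" and T :: "'a \<Rightarrow> 'k \<Rightarrow> real"
    and L :: "('k \<Rightarrow> real) set"
  assumes e_nonneg: "0 \<le> e"
    and compact: "compact_space K" and Hausdorff: "Hausdorff_space K"
    and sublattice: "vector_sublattice K L" and dense: "norm_dense K L"
    and iso: "vl_isomorphism T (principal_ideal e) L"
begin

definition coz :: "'a \<Rightarrow> 'k set" where
  "coz x = {t \<in> topspace K. T x t \<noteq> 0}"

lemmas I_closed = principal_ideal_closed[OF e_nonneg]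

lemma T_add: "x \<in> principal_ideal e \<Longrightarrow> y \<in> principal_ideal e \<Longrightarrow> T (x + y) t = T x t + T y t"
  and T_scaleR: "x \<in> principal_ideal e \<Longrightarrow> T (c *\<^sub>R x) t = c * T x t"
  and T_sup: "x \<in> principal_ideal e \<Longrightarrow> y \<in> principal_ideal e \<Longrightarrow> T (sup x y) t = max (T x t) (T y t)"
  and T_inf: "x \<in> principal_ideal e \<Longrightarrow> y \<in> principal_ideal e \<Longrightarrow> T (inf x y) t = min (T x t) (T y t)"
  using iso by (auto simp: vl_isomorphism_def)

lemma T_uminus: "x \<in> principal_ideal e \<Longrightarrow> T (- x) t = - T x t"
  using T_scaleR[of x "- 1" t] by simp

lemma T_zero: "T 0 t = 0"
  using T_scaleR[OF I_closed(2), of 0 t] by simp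

lemma I_diff: "x \<in> principal_ideal e \<Longrightarrow> y \<in> principal_ideal e \<Longrightarrow> x - y \<in> principal_ideal e"
  using I_closed(4)[OF _ I_closed(3), of x y] by simp

lemma T_diff: "x \<in> principal_ideal e \<Longrightarrow> y \<in> principal_ideal e \<Longrightarrow> T (x - y) t = T x t - T y t"
  using T_add[OF _ I_closed(3), of x y] by (simp add: T_uminus)

lemma I_abs: "x \<in> principal_ideal e \<Longrightarrow> \<bar>x\<bar> \<in> principal_ideal e"
  by (simp add: abs_lattice I_closed)

lemma T_abs: "x \<in> principal_ideal e \<Longrightarrow> T \<bar>x\<bar> t = \<bar>T x t\<bar>"
  by (simp add: abs_lattice[of x] I_closed T_sup T_uminus max_def)

lemma T_mono: "x \<in> principal_ideal e \<Longrightarrow> y \<in> principal_ideal e \<Longrightarrow> x \<le> y \<Longrightarrow> T x t \<le> T y t"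
  by (metis T_sup sup_absorb2 max.cobounded1)

lemma T_nonneg: "x \<in> principal_ideal e \<Longrightarrow> 0 \<le> x \<Longrightarrow> 0 \<le> T x t"
  using T_mono[OF I_closed(2)] by (simp add: T_zero)

lemma T_mem_cont_funs: "x \<in> principal_ideal e \<Longrightarrow> T x \<in> cont_funs K"
  using iso sublattice unfolding vl_isomorphism_def vector_sublattice_def
  by (auto dest: bij_betw_apply)

lemma continuous_T: "x \<in> principal_ideal e \<Longrightarrow> continuous_map K euclideanreal (T x)"
  using T_mem_cont_funs by (simp add: cont_funs_def)

lemma eq_zero_iff:
  assumes "x \<in> principal_ideal e"
  shows "x = 0 \<longleftrightarrow> (\<forall>t\<in>topspace K. T x t = 0)"
proof
  assume 0: "\<forall>t\<in>topspace K. T x t = 0"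
  have "T x = T 0"
  proof
    fix t show "T x t = T 0 t"
      using 0 T_mem_cont_funs[OF assms] by (cases "t \<in> topspace K") (auto simp: cont_funs_def T_zero)
  qed
  then show "x = 0"
    using iso assms I_closed(2) unfolding vl_isomorphism_def bij_betw_def by (blast dest: inj_onD)
qed (simp add: T_zero)

text \<open>
  \<open>I\<^sub>e\<close> is an ideal of the whole space; this is what makes suprema and disjointness computed in
  \<open>C(K)\<close> meaningful outside \<open>I\<^sub>e\<close>.
\<close>

lemma I_solid:
  assumes "x \<in> principal_ideal e" "\<bar>y\<bar> \<le> \<bar>x\<bar>"
  shows "y \<in> principal_ideal e"
proof -
  obtain a where a: "a \<ge> 0" "- (a *\<^sub>R e) \<le> \<bar>x\<bar>" "\<bar>x\<bar> \<le> a *\<^sub>R e"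
    using I_abs[OF assms(1)] principal_ideal_iff[OF e_nonneg] by blast
  then have "\<bar>y\<bar> \<le> a *\<^sub>R e" using assms(2) by (meson order_trans)
  then have "y \<le> a *\<^sub>R e" "- (a *\<^sub>R e) \<le> y" by (auto simp: abs_le_iff minus_le_iff)
  then show ?thesis using a principal_ideal_iff[OF e_nonneg] by blast
qed

lemma I_between: "0 \<le> y \<Longrightarrow> y \<le> x \<Longrightarrow> x \<in> principal_ideal e \<Longrightarrow> y \<in> principal_ideal e"
  by (rule I_solid[of x]) (auto intro: order_trans)

lemma openin_coz: "x \<in> principal_ideal e \<Longrightarrow> openin K (coz x)"
  using openin_continuous_map_preimage[OF continuous_T, of x "- {0}"]
  by (simp add: coz_def open_Compl)

lemma cozero_set_coz: "x \<in> principal_ideal e \<Longrightarrow> cozero_set_in K (coz x)"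
  using continuous_T by (auto simp: coz_def cozero_set_in_def)

lemma disjoint_iff_coz:
  assumes "x \<in> principal_ideal e" "y \<in> principal_ideal e"
  shows "inf \<bar>x\<bar> \<bar>y\<bar> = 0 \<longleftrightarrow> coz x \<inter> coz y = {}"
  unfolding eq_zero_iff[OF I_closed(7)[OF I_abs[OF assms(1)] I_abs[OF assms(2)]]]
  by (auto simp: coz_def T_inf T_abs I_abs assms min_def)

lemma approx:
  assumes "continuous_map K euclideanreal f" "\<epsilon> > 0"
  obtains x where "x \<in> principal_ideal e" "\<And>t. t \<in> topspace K \<Longrightarrow> \<bar>f t - T x t\<bar> < \<epsilon>"
proof -
  define f' where "f' t = (if t \<in> topspace K then f t else 0)" for t
  have "continuous_map K euclideanreal f'"
    using assms(1) by (rule continuous_map_eq) (simp add: f'_def)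
  then have "f' \<in> cont_funs K" by (simp add: cont_funs_def f'_def)
  then obtain g where g: "g \<in> L" "\<And>t. t \<in> topspace K \<Longrightarrow> \<bar>f' t - g t\<bar> < \<epsilon>"
    using dense assms(2) unfolding norm_dense_def by blast
  moreover obtain x where "x \<in> principal_ideal e" "g = T x"
    using iso g(1) unfolding vl_isomorphism_def bij_betw_def by blast
  ultimately show ?thesis using that by (simp add: f'_def)
qed

text \<open>
  Density provides an element of \<open>I\<^sub>e\<close> whose image is positive at \<open>t\<close>, and a multiple of \<open>e\<close>
  dominates it.
\<close>

lemma T_e_pos:
  assumes "t \<in> topspace K"
  shows "0 < T e t"
proof -
  obtain x where x: "x \<in> principal_ideal e" "\<And>t. t \<in> topspace K \<Longrightarrow> \<bar>1 - T x t\<bar> < 1"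
    using approx[of "\<lambda>_. 1" 1] by auto
  obtain a where a: "a \<ge> 0" "x \<le> a *\<^sub>R e" using x principal_ideal_iff[OF e_nonneg] by blast
  have "0 < T x t" using x(2)[OF assms] by linarith
  also have "\<dots> \<le> a * T e t"
    using T_mono[OF x(1) I_closed(5)[OF I_closed(1)] a(2)] by (simp add: T_scaleR I_closed)
  finally show ?thesis using a(1) by (simp add: zero_less_mult_iff)
qed

text \<open>
  An arbitrary continuous function is outside the range of \<open>T\<close>, but its sign pattern can be realised
  up to a tolerance \<open>\<delta>\<close>: rescale \<open>f\<close> so that \<open>\<delta>\<close> becomes 4, approximate it, subtract twice an
  approximate constant 1, and take the positive part.  The errors \<open>1/2\<close> and \<open>1/4\<close> leave room for the
  exact value 0 where \<open>f \<le> 0\<close> and for the lower bound 1 where \<open>f \<ge> \<delta>\<close>.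
\<close>

lemma truncation:
  assumes f: "continuous_map K euclideanreal f" and \<delta>: "\<delta> > 0"
  obtains x where "x \<in> principal_ideal e" "0 \<le> x"
    "\<And>t. t \<in> topspace K \<Longrightarrow> f t \<le> 0 \<Longrightarrow> T x t = 0"
    "\<And>t. t \<in> topspace K \<Longrightarrow> \<delta> \<le> f t \<Longrightarrow> 1 \<le> T x t"
proof -
  obtain u where u: "u \<in> principal_ideal e" "\<And>t. t \<in> topspace K \<Longrightarrow> \<bar>1 - T u t\<bar> < 1/4"
    using approx[of "\<lambda>_. 1" "1/4"] by auto
  have "continuous_map K euclideanreal (\<lambda>t. 4/\<delta> * f t)" using f by (intro continuous_intros)
  then obtain y where y: "y \<in> principal_ideal e"
    "\<And>t. t \<in> topspace K \<Longrightarrow> \<bar>4/\<delta> * f t - T y t\<bar> < 1/2"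
    using approx[of "\<lambda>t. 4/\<delta> * f t" "1/2"] half_gt_zero[OF zero_less_one] by blast
  define x where "x = sup (y - 2 *\<^sub>R u) 0"
  have x: "x \<in> principal_ideal e" unfolding x_def by (intro I_closed I_diff u y)
  have T: "T x t = max (T y t - 2 * T u t) 0" for t
    using u(1) y(1) by (simp add: x_def T_sup T_diff T_scaleR T_zero I_closed I_diff)
  show ?thesis
  proof (rule that[OF x])
    show "0 \<le> x" by (simp add: x_def)
    fix t assume t: "t \<in> topspace K"
    show "T x t = 0" if "f t \<le> 0"
    proof -
      have "4/\<delta> * f t \<le> 0" using that \<delta> by (simp add: mult_le_0_iff divide_le_0_iff)
      then show ?thesis using u(2)[OF t] y(2)[OF t] unfolding T by linarith
    qed
    show "1 \<le> T x t" if "\<delta> \<le> f t"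
    proof -
      have "4/\<delta> * f t \<ge> 4" using that \<delta> by (simp add: field_simps)
      then show ?thesis using u(2)[OF t] y(2)[OF t] unfolding T by linarith
    qed
  qed
qed

lemma Urysohn_function:
  assumes "closedin K A" "closedin K B" "A \<inter> B = {}"
  obtains x where "x \<in> principal_ideal e" "0 \<le> x"
    "\<And>t. t \<in> A \<Longrightarrow> T x t = 0" "\<And>t. t \<in> B \<Longrightarrow> 1 \<le> T x t"
proof -
  have "normal_space K"
    using compact Hausdorff by (simp add: compact_Hausdorff_or_regular_imp_normal_space)
  then obtain f where f: "continuous_map K euclideanreal f" "f ` A \<subseteq> {0}" "f ` B \<subseteq> {1}"
    using Urysohn_lemma_alt[OF _ assms(1,2), of 0 1] assms(3) by (auto simp: disjnt_def)
  obtain x where "x \<in> principal_ideal e" "0 \<le> x"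
    "\<And>t. t \<in> topspace K \<Longrightarrow> f t \<le> 0 \<Longrightarrow> T x t = 0"
    "\<And>t. t \<in> topspace K \<Longrightarrow> 1 \<le> f t \<Longrightarrow> 1 \<le> T x t"
    using truncation[OF f(1), of 1] by auto
  then show ?thesis
    using that[of x] f(2,3) closedin_subset[OF assms(1)] closedin_subset[OF assms(2)] by fastforce
qed

lemma bump:
  assumes "openin K W" "t \<in> W"
  obtains x where "x \<in> principal_ideal e" "0 \<le> x" "coz x \<subseteq> W" "t \<in> coz x"
proof -
  have t: "t \<in> topspace K" using assms openin_subset by blast
  obtain x where x: "x \<in> principal_ideal e" "0 \<le> x"
    "\<And>s. s \<in> topspace K - W \<Longrightarrow> T x s = 0" "\<And>s. s \<in> {t} \<Longrightarrow> 1 \<le> T x s"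
  proof (rule Urysohn_function[of "topspace K - W" "{t}"])
    show "closedin K (topspace K - W)" using assms(1) by blast
    show "closedin K {t}" using t Hausdorff by (simp add: closedin_Hausdorff_singleton)
  qed (use assms(2) in auto)
  show ?thesis
  proof (rule that[OF x(1,2)])
    show "coz x \<subseteq> W" using x(3) by (auto simp: coz_def)
    show "t \<in> coz x" using x(4)[of t] t by (auto simp: coz_def)
  qed
qed

lemma T_bounded:
  assumes "x \<in> principal_ideal e"
  obtains M where "M > 0" "\<And>t. t \<in> topspace K \<Longrightarrow> T x t \<le> M"
proof -
  have "compactin euclideanreal (T x ` topspace K)"
    by (rule image_compactin[OF _ continuous_T[OF assms]]) (use compact in \<open>simp add: compact_space_def\<close>)
  then have "bounded (T x ` topspace K)" by (simp add: compact_imp_bounded)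
  then obtain M where "\<forall>t\<in>topspace K. \<bar>T x t\<bar> \<le> M" by (auto simp: bounded_iff)
  then show ?thesis using that[of "\<bar>M\<bar> + 1"] by force
qed

section \<open>Decompositions of the unit and clopen sets\<close>

text \<open>
  The closure is shown to be the cozero set of the component \<open>b\<close> of \<open>e\<close> in \<open>B\<close>, whose complement is
  the cozero set of the complementary component \<open>c\<close>.
\<close>

lemma openin_closure_if_projection_band:
  assumes S: "S \<subseteq> principal_ideal e" and SB: "S \<subseteq> B"
    and BS: "B \<subseteq> disjoint_complement (disjoint_complement S)" and B: "projection_band B"
  shows "openin K (K closure_of (\<Union>x\<in>S. coz x))"
proof -
  obtain b c where bB: "b \<in> B" and cB: "c \<in> disjoint_complement B" and ebc: "e = b + c"
    using B e_nonneg unfolding projection_band_def by blast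
  have b: "b \<in> disjoint_complement (disjoint_complement S)" using bB BS by blast
  have c: "c \<in> disjoint_complement S" using cB SB by (auto simp: disjoint_complement_def)
  have disj: "inf \<bar>b\<bar> \<bar>c\<bar> = 0" using b c unfolding disjoint_complement_def by blast
  have bc0: "0 \<le> b" "0 \<le> c"
    using nonneg_if_disjoint_sum_nonneg[of b c] nonneg_if_disjoint_sum_nonneg[of c b] disj e_nonneg
    by (simp_all add: ebc inf_commute add.commute)
  have bI: "b \<in> principal_ideal e"
    by (rule I_between[OF bc0(1) _ I_closed(1)]) (simp add: ebc bc0)
  have cI: "c \<in> principal_ideal e"
    by (rule I_between[OF bc0(2) _ I_closed(1)]) (simp add: ebc bc0)
  have coz_c: "coz c = topspace K - coz b"
  proof -
    have "coz b \<inter> coz c = {}" using disj disjoint_iff_coz[OF bI cI] by simp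
    moreover have "t \<in> coz b \<union> coz c" if "t \<in> topspace K" for t
      using T_e_pos[OF that] that T_add[OF bI cI, of t] by (auto simp: coz_def ebc)
    ultimately show ?thesis by (auto simp: coz_def)
  qed
  have "K closure_of (\<Union>x\<in>S. coz x) = coz b"
  proof
    have "coz x \<inter> coz c = {}" if "x \<in> S" for x
      using that c S cI by (subst disjoint_iff_coz[symmetric]) (auto simp: disjoint_complement_def inf_commute)
    then have "(\<Union>x\<in>S. coz x) \<subseteq> coz b" using coz_c by (auto simp: coz_def)
    moreover have "closedin K (coz b)"
      using openin_coz[OF cI] by (auto simp: closedin_def coz_c) (auto simp: coz_def)
    ultimately show "K closure_of (\<Union>x\<in>S. coz x) \<subseteq> coz b" by (rule closure_of_minimal)
  next
    show "coz b \<subseteq> K closure_of (\<Union>x\<in>S. coz x)"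
    proof (rule ccontr)
      assume "\<not> ?thesis"
      then obtain t where t: "t \<in> coz b - K closure_of (\<Union>x\<in>S. coz x)" by blast
      \<comment> \<open>A bump \<open>g\<close> in the part of \<open>coz b\<close> missed by the closure is disjoint from \<open>S\<close> but meets \<open>b\<close>.\<close>
      have "openin K (coz b - K closure_of (\<Union>x\<in>S. coz x))"
        by (intro openin_diff openin_coz bI closedin_closure_of)
      then obtain g where g: "g \<in> principal_ideal e" "t \<in> coz g"
        "coz g \<subseteq> coz b - K closure_of (\<Union>x\<in>S. coz x)" using bump t by metis
      have "coz g \<inter> coz x = {}" if "x \<in> S" for x
        using closure_of_subset[of "\<Union>x\<in>S. coz x" K] g(3) that by (auto simp: coz_def)
      then have "g \<in> disjoint_complement S"
        using S g(1) by (auto simp: disjoint_complement_def disjoint_iff_coz subset_iff)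
      then have "inf \<bar>b\<bar> \<bar>g\<bar> = 0" using b by (simp add: disjoint_complement_def)
      then show False using g t by (auto simp: disjoint_iff_coz bI)
    qed
  qed
  then show ?thesis using openin_coz[OF bI] by simp
qed

text \<open>
  The component of \<open>e\<close> in \<open>B\<close> is the element \<open>b\<close> represented by \<open>T e\<close> on the clopen set and by zero
  off it.  That \<open>b\<close> is a supremum of elements of \<open>B\<close> is checked at the points of \<open>U\<close>, where
  multiples of elements of \<open>B\<close> reach \<open>b\<close>; density of \<open>U\<close> does the rest.
\<close>

lemma decomposition_if_openin_closure:
  assumes B: "band B"
    and op: "openin K (K closure_of (\<Union>x\<in>B \<inter> principal_ideal e. coz x))" (is "openin K ?V")
  shows "\<exists>b\<in>B. \<exists>c\<in>disjoint_complement B. e = b + c"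
proof -
  let ?I = "principal_ideal e"
  have ideal: "ideal B" using B by (simp add: band_def)
  have V: "?V \<subseteq> topspace K" by (rule closure_of_subset_topspace)
  obtain x where x: "x \<in> ?I" "0 \<le> x" "\<And>t. t \<in> topspace K - ?V \<Longrightarrow> T x t = 0"
    "\<And>t. t \<in> ?V \<Longrightarrow> 1 \<le> T x t"
    using Urysohn_function[of "topspace K - ?V" ?V] op by auto
  obtain M where M: "M > 0" "\<And>t. t \<in> topspace K \<Longrightarrow> T e t \<le> M" using T_bounded[OF I_closed(1)] by blast
  define b where "b = inf e (M *\<^sub>R x)"
  have bI: "b \<in> ?I" unfolding b_def by (intro I_closed x)
  have b0: "0 \<le> b" using e_nonneg x(2) M(1) by (simp add: b_def scaleR_nonneg_nonneg)
  have be: "b \<le> e" by (simp add: b_def)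
  have Tb: "T b t = min (T e t) (M * T x t)" for t
    using x(1) by (simp add: b_def T_inf T_scaleR I_closed)
  have Tb_in: "T b t = T e t" if "t \<in> ?V" for t
  proof -
    have "M * 1 \<le> M * T x t" using x(4)[OF that] M(1) by (intro mult_left_mono) auto
    then show ?thesis using M(2)[of t] that V unfolding Tb by auto
  qed
  have Tb_out: "T b t = 0" if "t \<in> topspace K - ?V" for t
    using x(3)[OF that] T_e_pos[of t] that unfolding Tb by auto
  have cI: "e - b \<in> ?I" by (intro I_diff I_closed bI)
  have lub: "isLub UNIV {f \<in> B. 0 \<le> f \<and> f \<le> b} b"
  proof (rule isLubI2, rule isUb_UNIV_I)
    show "b <=* Collect (isUb UNIV {f \<in> B. 0 \<le> f \<and> f \<le> b})"
    proof (rule setgeI, rule ballI)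
      fix g assume "g \<in> Collect (isUb UNIV {f \<in> B. 0 \<le> f \<and> f \<le> b})"
      then have g: "f \<le> g" if "f \<in> B" "0 \<le> f" "f \<le> b" for f using that by (blast dest: isUbD)
      have "0 \<le> g" using g[of 0] b0 subspace_0[OF idealD(1)[OF ideal]] by simp
      then have gb: "inf g b \<in> ?I" using b0 by (intro I_between[OF _ _ bI]) auto
      have "T (b - inf g b) t = 0" if t: "t \<in> topspace K" for t
      proof (rule ccontr)
        assume ne: "T (b - inf g b) t \<noteq> 0"
        have dI: "b - inf g b \<in> ?I" by (intro I_diff bI gb)
        have "0 \<le> b - inf g b" "0 \<le> inf g b" using \<open>0 \<le> g\<close> b0 by (simp_all only: diff_ge_0_iff_ge le_inf_iff inf_le2)
        then have "0 \<le> T (b - inf g b) t" "0 \<le> T (inf g b) t"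
          using T_nonneg[OF dI] T_nonneg[OF gb] by blast+
        then have "T b t \<noteq> 0" using ne T_diff[OF bI gb, of t] by linarith
        then have "t \<in> ?V" using Tb_out t by blast
        moreover have "openin K (coz (b - inf g b))" "t \<in> coz (b - inf g b)"
          using ne t openin_coz[OF dI] by (auto simp: coz_def)
        ultimately obtain s f where s: "s \<in> coz (b - inf g b)" "s \<in> coz f" "f \<in> B" "f \<in> ?I"
          unfolding in_closure_of by blast
        \<comment> \<open>The multiple of \<open>\<bar>f\<bar>\<close> that attains the value of \<open>b\<close> at \<open>s\<close>.\<close>
        define n where "n = T b s / \<bar>T f s\<bar>"
        have n0: "n \<ge> 0" using T_nonneg[OF bI b0] by (simp add: n_def)
        have nf: "n *\<^sub>R \<bar>f\<bar> \<in> ?I" by (intro I_closed I_abs s)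
        have "\<bar>f\<bar> \<in> B" using idealD(2)[OF ideal s(3), of "\<bar>f\<bar>"] by simp
        then have nfB: "n *\<^sub>R \<bar>f\<bar> \<in> B" using subspace_scale[OF idealD(1)[OF ideal]] by blast
        have nf0: "0 \<le> n *\<^sub>R \<bar>f\<bar>" using n0 by (simp add: scaleR_nonneg_nonneg)
        have "inf (n *\<^sub>R \<bar>f\<bar>) b \<in> B"
          using nf0 b0 by (intro idealD(2)[OF ideal nfB]) simp
        then have "inf (n *\<^sub>R \<bar>f\<bar>) b \<le> inf g b" using g[of "inf (n *\<^sub>R \<bar>f\<bar>) b"] nf0 b0 by simp
        then have "T (inf (n *\<^sub>R \<bar>f\<bar>) b) s \<le> T (inf g b) s"
          by (rule T_mono[OF I_closed(7)[OF nf bI] gb])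
        moreover have "T (n *\<^sub>R \<bar>f\<bar>) s = T b s"
          using s(2,4) by (simp add: T_scaleR I_abs T_abs n_def coz_def)
        then have "T (inf (n *\<^sub>R \<bar>f\<bar>) b) s = T b s" by (simp add: T_inf nf bI)
        moreover have "T (inf g b) s \<le> T b s" by (rule T_mono[OF gb bI]) simp
        moreover have "T (b - inf g b) s \<noteq> 0" using s(1) unfolding coz_def by blast
        moreover have "T (b - inf g b) s = T b s - T (inf g b) s" by (rule T_diff[OF bI gb])
        ultimately show False by linarith
      qed
      then have "b - inf g b = 0" using eq_zero_iff[OF I_diff[OF bI gb]] by blast
      then show "b \<le> g" by (metis eq_iff_diff_eq_0 inf_le1)
    qed
  qed auto
  have bB: "b \<in> B" by (rule bandD[OF B _ lub]) auto
  have "e - b \<in> disjoint_complement B"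
    unfolding disjoint_complement_def
  proof (intro CollectI ballI)
    fix h assume h: "h \<in> B"
    define w where "w = inf \<bar>e - b\<bar> \<bar>h\<bar>"
    have w0: "0 \<le> w" by (simp add: w_def)
    have we: "w \<le> e - b" using be by (simp add: w_def le_infI1)
    have wI: "w \<in> ?I" by (rule I_between[OF w0 we cI])
    have wB: "w \<in> B" using idealD(2)[OF ideal h, of w] w0 by (simp add: w_def)
    have "T w t = 0" if t: "t \<in> topspace K" for t
    proof (cases "t \<in> ?V")
      case True
      have "T w t \<le> T (e - b) t" by (rule T_mono[OF wI cI we])
      then show ?thesis using T_nonneg[OF wI w0, of t] Tb_in[OF True] by (simp add: T_diff I_closed bI)
    next
      case False
      have "coz w \<subseteq> ?V" using closure_of_subset[of "\<Union>x\<in>B \<inter> ?I. coz x" K] wB wI by (auto simp: coz_def)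
      then show ?thesis using False t by (auto simp: coz_def)
    qed
    then show "inf \<bar>e - b\<bar> \<bar>h\<bar> = 0" using eq_zero_iff[OF wI] by (simp add: w_def)
  qed
  then show ?thesis using bB by (intro bexI[of _ b] bexI[of _ "e - b"]) auto
qed

section \<open>Projection properties and disconnectedness\<close>

text \<open>
  By bump functions, every open set is the union of the cozero sets it contains.
\<close>

lemma extremally_disconnected_if_has_PP:
  assumes "has_PP TYPE('a)"
  shows "extremally_disconnected K"
  unfolding extremally_disconnected_def
proof (intro allI impI)
  fix U assume U: "openin K U"
  define S where "S = {x \<in> principal_ideal e. coz x \<subseteq> U}"
  have "(\<Union>x\<in>S. coz x) = U"
  proof
    show "U \<subseteq> (\<Union>x\<in>S. coz x)" using bump[OF U] unfolding S_def by blast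
  qed (auto simp: S_def)
  moreover have "projection_band (disjoint_complement (disjoint_complement S))"
    using assms band_disjoint_complement unfolding has_PP_def by blast
  ultimately show "openin K (K closure_of U)"
    using openin_closure_if_projection_band[of S] subset_double_disjoint_complement[of S]
    by (auto simp: S_def)
qed

text \<open>
  The truncations of \<open>\<bar>g\<bar>\<close> at the levels \<open>1/(n+1)\<close> are countably many elements of \<open>I\<^sub>e\<close> whose cozero
  sets exhaust that of \<open>g\<close>.
\<close>

lemma basically_disconnected_if_has_sigma_PP:
  assumes "has_sigma_PP TYPE('a)"
  shows "basically_disconnected K"
  unfolding basically_disconnected_def
proof (intro allI impI)
  fix U assume "cozero_set_in K U"
  then obtain g where g: "continuous_map K euclideanreal g" "U = {t \<in> topspace K. g t \<noteq> 0}"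
    by (auto simp: cozero_set_in_def)
  have "\<exists>x\<in>principal_ideal e. (\<forall>t\<in>topspace K. g t = 0 \<longrightarrow> T x t = 0) \<and>
      (\<forall>t\<in>topspace K. inverse (real (Suc n)) \<le> \<bar>g t\<bar> \<longrightarrow> 1 \<le> T x t)" for n
  proof -
    have "continuous_map K euclideanreal (\<lambda>t. \<bar>g t\<bar>)" using g(1) by (rule continuous_map_real_abs)
    moreover have "0 < inverse (real (Suc n))" by simp
    ultimately obtain x where "x \<in> principal_ideal e" "\<And>t. t \<in> topspace K \<Longrightarrow> \<bar>g t\<bar> \<le> 0 \<Longrightarrow> T x t = 0"
      "\<And>t. t \<in> topspace K \<Longrightarrow> inverse (real (Suc n)) \<le> \<bar>g t\<bar> \<Longrightarrow> 1 \<le> T x t"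
      using truncation by blast
    then show ?thesis by auto
  qed
  then obtain x where x: "\<And>n. x n \<in> principal_ideal e"
    "\<And>n t. t \<in> topspace K \<Longrightarrow> g t = 0 \<Longrightarrow> T (x n) t = 0"
    "\<And>n t. t \<in> topspace K \<Longrightarrow> inverse (real (Suc n)) \<le> \<bar>g t\<bar> \<Longrightarrow> 1 \<le> T (x n) t" by metis
  define B where "B = \<Inter>{B. band B \<and> range x \<subseteq> B}"
  have "band B" unfolding B_def by (rule band_Inter) blast
  moreover have xB: "range x \<subseteq> B" and least: "\<And>B'. band B' \<Longrightarrow> range x \<subseteq> B' \<Longrightarrow> B \<subseteq> B'"
    unfolding B_def by blast+
  ultimately have "countably_generated_band B"
    unfolding countably_generated_band_def by (intro conjI exI[of _ "range x"]) auto
  then have "projection_band B" using assms by (simp add: has_sigma_PP_def)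
  moreover have "B \<subseteq> disjoint_complement (disjoint_complement (range x))"
    by (intro least band_disjoint_complement subset_double_disjoint_complement)
  moreover have "U = (\<Union>y\<in>range x. coz y)"
  proof
    show "U \<subseteq> (\<Union>y\<in>range x. coz y)"
    proof
      fix t assume t: "t \<in> U"
      then obtain n where "inverse (real (Suc n)) < \<bar>g t\<bar>" using reals_Archimedean[of "\<bar>g t\<bar>"] g(2) by auto
      then have "1 \<le> T (x n) t" using x(3)[of t n] t g(2) by simp
      then show "t \<in> (\<Union>y\<in>range x. coz y)" using t g(2) by (auto simp: coz_def intro!: exI[of _ n])
    qed
    show "(\<Union>y\<in>range x. coz y) \<subseteq> U" using x(2) g(2) by (auto simp: coz_def)
  qed
  ultimately show "openin K (K closure_of U)"
    using openin_closure_if_projection_band[of "range x" B] x(1) xB by blast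
qed

text \<open>
  The generators need not lie in \<open>I\<^sub>e\<close>, so they are cut down to \<open>\<bar>s\<bar> \<sqinter> e\<close>.  If some \<open>f \<in> B\<close> were
  nonzero at a point outside the closure of the right-hand union, a bump \<open>g\<close> there would be disjoint
  from all of \<open>S\<close>; then the band of elements disjoint from \<open>g\<close> would contain \<open>S\<close>, hence \<open>B\<close>, hence \<open>f\<close>.
\<close>

lemma closure_coz_generated_band:
  assumes B: "band B" and SB: "S \<subseteq> B" and least: "\<And>B'. band B' \<Longrightarrow> S \<subseteq> B' \<Longrightarrow> B \<subseteq> B'"
  shows "K closure_of (\<Union>x\<in>B \<inter> principal_ideal e. coz x) = K closure_of (\<Union>s\<in>S. coz (inf \<bar>s\<bar> e))"
    (is "K closure_of ?U = K closure_of ?V")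
proof
  have ideal: "ideal B" using B by (simp add: band_def)
  have meet: "inf \<bar>s\<bar> e \<in> principal_ideal e" for s
    by (rule I_between[OF _ _ I_closed(1)]) (use e_nonneg in auto)
  have "inf \<bar>s\<bar> e \<in> B" if "s \<in> S" for s
    using idealD(2)[OF ideal, of s "inf \<bar>s\<bar> e"] that SB e_nonneg by auto
  then show "K closure_of ?V \<subseteq> K closure_of ?U" using meet by (intro closure_of_mono) blast
  show "K closure_of ?U \<subseteq> K closure_of ?V"
  proof (rule closure_of_minimal[OF _ closedin_closure_of], rule ccontr)
    assume "\<not> ?U \<subseteq> K closure_of ?V"
    then obtain f t where f: "f \<in> B" "f \<in> principal_ideal e" "t \<in> coz f - K closure_of ?V" by blast
    have "openin K (coz f - K closure_of ?V)" by (intro openin_diff openin_coz f closedin_closure_of)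
    then obtain g where g: "g \<in> principal_ideal e" "t \<in> coz g" "coz g \<subseteq> coz f - K closure_of ?V"
      using bump f(3) by metis
    have "inf \<bar>s\<bar> \<bar>g\<bar> = 0" if s: "s \<in> S" for s
    proof -
      define y where "y = inf \<bar>s\<bar> \<bar>g\<bar>"
      have y0: "0 \<le> y" by (simp add: y_def)
      have yg: "y \<le> \<bar>g\<bar>" by (simp add: y_def)
      have yI: "y \<in> principal_ideal e" by (rule I_between[OF y0 yg I_abs[OF g(1)]])
      have "T y r = 0" if r: "r \<in> topspace K" for r
      proof (cases "r \<in> coz g")
        case True
        then have "r \<notin> ?V" using g(3) closure_of_subset[of ?V K] by (auto simp: coz_def)
        then have "T (inf \<bar>s\<bar> e) r = 0" using s r by (auto simp: coz_def)
        moreover have "T (inf y e) r \<le> T (inf \<bar>s\<bar> e) r"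
          by (rule T_mono[OF I_closed(7)[OF yI I_closed(1)] meet]) (simp add: y_def le_infI1)
        ultimately have "min (T y r) (T e r) \<le> 0" using T_inf[OF yI I_closed(1), of r] by simp
        then show ?thesis using T_e_pos[OF r] T_nonneg[OF yI y0, of r] by linarith
      next
        case False
        then have "T \<bar>g\<bar> r = 0" using r g(1) by (simp add: coz_def T_abs)
        then show ?thesis using T_mono[OF yI I_abs[OF g(1)] yg, of r] T_nonneg[OF yI y0, of r] by linarith
      qed
      then show ?thesis using eq_zero_iff[OF yI] by (simp add: y_def)
    qed
    then have "S \<subseteq> disjoint_complement {g}" by (auto simp: disjoint_complement_def)
    then have "f \<in> disjoint_complement {g}" using least[OF band_disjoint_complement] f(1) by blast
    then have "coz f \<inter> coz g = {}" using f(2) g(1) by (simp add: disjoint_complement_def disjoint_iff_coz)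
    then show False using g(2) f(3) by blast
  qed
qed

lemma decomposition_if_extremally_disconnected:
  assumes "extremally_disconnected K" "band B"
  shows "\<exists>b\<in>B. \<exists>c\<in>disjoint_complement B. e = b + c"
proof (rule decomposition_if_openin_closure[OF assms(2)])
  have "openin K (\<Union>x\<in>B \<inter> principal_ideal e. coz x)" using openin_coz by blast
  then show "openin K (K closure_of (\<Union>x\<in>B \<inter> principal_ideal e. coz x))"
    using assms(1) by (simp add: extremally_disconnected_def)
qed

lemma decomposition_if_basically_disconnected:
  assumes K: "basically_disconnected K" and B: "countably_generated_band B"
  shows "\<exists>b\<in>B. \<exists>c\<in>disjoint_complement B. e = b + c"
proof (rule decomposition_if_openin_closure)
  show "band B" using B by (simp add: countably_generated_band_def)
  obtain S where S: "countable S" "S \<subseteq> B" "\<And>B'. band B' \<Longrightarrow> S \<subseteq> B' \<Longrightarrow> B \<subseteq> B'"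
    using B by (auto simp: countably_generated_band_def)
  have "cozero_set_in K (\<Union>s\<in>S. coz (inf \<bar>s\<bar> e))"
    using e_nonneg by (intro cozero_set_in_UN S cozero_set_coz I_between[OF _ _ I_closed(1)]) auto
  then have "openin K (K closure_of (\<Union>s\<in>S. coz (inf \<bar>s\<bar> e)))"
    using K by (simp add: basically_disconnected_def)
  then show "openin K (K closure_of (\<Union>x\<in>B \<inter> principal_ideal e. coz x))"
    by (subst closure_coz_generated_band[OF \<open>band B\<close> S(2)]) (rule S(3))
qed

end

theorem corollary3p16:
  fixes K :: "'a::vector_lattice \<Rightarrow> 'k topology"
  assumes "archimedean_vl TYPE('a)"
    and "\<And>e. 0 \<le> e \<Longrightarrow> krein_kakutani_spectrum e (K e)"
  shows "(has_PP TYPE('a) \<longleftrightarrow> (\<forall>e\<ge>0. extremally_disconnected (K e))) \<and>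
         (has_sigma_PP TYPE('a) \<longleftrightarrow> (\<forall>e\<ge>0. basically_disconnected (K e)))"
proof -
  have rep: "\<exists>T L. krein_kakutani_representation e (K e) T L" if "0 \<le> e" for e
    using assms(2)[OF that] that
    unfolding krein_kakutani_spectrum_def krein_kakutani_representation_def by blast
  have "has_PP TYPE('a)" if K: "\<forall>e\<ge>0. extremally_disconnected (K e)"
    unfolding has_PP_def
  proof (intro allI impI)
    fix B :: "'a set" assume B: "band B"
    then have "ideal B" by (simp add: band_def)
    moreover have "\<exists>b\<in>B. \<exists>c\<in>disjoint_complement B. e = b + c" if "0 \<le> e" for e
      using rep[OF that] K that B
        krein_kakutani_representation.decomposition_if_extremally_disconnected by blast
    ultimately show "projection_band B" by (simp add: projection_band_iff_nonneg)
  qed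
  moreover have "has_sigma_PP TYPE('a)" if K: "\<forall>e\<ge>0. basically_disconnected (K e)"
    unfolding has_sigma_PP_def
  proof (intro allI impI)
    fix B :: "'a set" assume B: "countably_generated_band B"
    then have "ideal B" by (simp add: countably_generated_band_def band_def)
    moreover have "\<exists>b\<in>B. \<exists>c\<in>disjoint_complement B. e = b + c" if "0 \<le> e" for e
      using rep[OF that] K that B
        krein_kakutani_representation.decomposition_if_basically_disconnected by blast
    ultimately show "projection_band B" by (simp add: projection_band_iff_nonneg)
  qed
  moreover have "extremally_disconnected (K e)" if "has_PP TYPE('a)" "0 \<le> e" for e
    using rep[OF that(2)] that(1)
      krein_kakutani_representation.extremally_disconnected_if_has_PP by blast
  moreover have "basically_disconnected (K e)" if "has_sigma_PP TYPE('a)" "0 \<le> e" for e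
    using rep[OF that(2)] that(1)
      krein_kakutani_representation.basically_disconnected_if_has_sigma_PP by blast
  ultimately show ?thesis by blast
qed

end
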